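(* Let $k\ge1$ be an integer and $a,b,c,d\ge0$. The elliptic system $$\phi''-\phi+f(\phi,\psi)=0,\qquad \psi''-\psi+g(\phi,\psi)=0$$ has at least one ground state solution.
   Context: $H(u,v)=\frac{a}{2k+2}(u^{2k+2}+v^{2k+2})+\frac{b}{k+1}(uv)^{k+1}+\frac{c}{k}u^{k+2}v^k+\frac{d}{k}u^kv^{k+2}$, $f(u,v)=H_u=a u^{2k+1}+b u^kv^{k+1}+\frac{k+2}{k}c\,u^{k+1}v^k+d\,u^{k-1}v^{k+2}$, $g(u,v)=H_v=a v^{2k+1}+b v^ku^{k+1}+\frac{k+2}{k}d\,v^{k+1}u^k+c\,v^{k-1}u^{k+2}$. Action functional $I(u,v)=\frac12\|(u,v)\|^2+\frac12\|\partial_x(u,v)\|^2-\int_{\mathbb{R}}H(u,v)dx$ on $H^1(\mathbb{R})\times H^1(\mathbb{R})$, where $\|(u,v)\|^2=\|u\|_{L^2}^2+\|v\|_{L^2}^2$, $\|\partial_x(u,v)\|^2=\|u'\|_{L^2}^2+\|v'\|_{L^2}^2$. A (weak) solution is $(\phi,\psi)\in H^1\times H^1$ with $\int(\phi w+\phi'w'-f(\phi,\psi)w)dx=0$ and $\int(\psi z+\psi'z'-g(\phi,\psi)z)dx=0$ for all $w,z\in H^1$ (equivalently $I'(\phi,\psi)=0$). A ground state is a real-valued solution $(\phi,\psi)\ne(0,0)$ with $I(\phi,\psi)=\inf\{I(u,v):(u,v)\neq(0,0),\ I'(u,v)=0\}$.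
   Formalization: The case a=b=c=d=0 is excluded by assuming a+b+c+d>0: there f=g=0, the only solution in H^1 is (0,0), and no ground state exists, so the claim as written fails in exactly that case. *)

theory Defs
  imports "HOL-Analysis.Analysis"
begin

definition HH :: "nat \<Rightarrow> real \<Rightarrow> real \<Rightarrow> real \<Rightarrow> real \<Rightarrow> real \<Rightarrow> real \<Rightarrow> real" where
  "HH k a b c d u v =
     a / (2 * real k + 2) * (u ^ (2*k+2) + v ^ (2*k+2)) + b / (real k + 1) * (u * v) ^ (k+1)
     + c / real k * u ^ (k+2) * v ^ k + d / real k * u ^ k * v ^ (k+2)"

definition ff :: "nat \<Rightarrow> real \<Rightarrow> real \<Rightarrow> real \<Rightarrow> real \<Rightarrow> real \<Rightarrow> real \<Rightarrow> real" where
  "ff k a b c d u v =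
     a * u ^ (2*k+1) + b * u ^ k * v ^ (k+1) + (real k + 2) / real k * c * u ^ (k+1) * v ^ k
     + d * u ^ (k-1) * v ^ (k+2)"

definition gg :: "nat \<Rightarrow> real \<Rightarrow> real \<Rightarrow> real \<Rightarrow> real \<Rightarrow> real \<Rightarrow> real \<Rightarrow> real" where
  "gg k a b c d u v =
     a * v ^ (2*k+1) + b * v ^ k * u ^ (k+1) + (real k + 2) / real k * d * v ^ (k+1) * u ^ k
     + c * v ^ (k-1) * u ^ (k+2)"

definition test_fun :: "(real \<Rightarrow> real) \<Rightarrow> bool" where
  "test_fun \<phi> \<longleftrightarrow> (\<forall>n x. ((deriv ^^ n) \<phi>) differentiable (at x))
                    \<and> compact (closure {x. \<phi> x \<noteq> 0})"

definition L2 :: "(real \<Rightarrow> real) set" where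
  "L2 = {u. u \<in> borel_measurable lborel \<and> integrable lborel (\<lambda>x. (u x)^2)}"

definition has_weak_deriv :: "(real \<Rightarrow> real) \<Rightarrow> (real \<Rightarrow> real) \<Rightarrow> bool" where
  "has_weak_deriv u w \<longleftrightarrow>
     (\<forall>\<phi>. test_fun \<phi> \<longrightarrow>
        integral\<^sup>L lborel (\<lambda>x. u x * deriv \<phi> x) = - integral\<^sup>L lborel (\<lambda>x. w x * \<phi> x))"

definition H1 :: "(real \<Rightarrow> real) set" where
  "H1 = {u. u \<in> L2 \<and> (\<exists>w\<in>L2. has_weak_deriv u w)}"

definition wderiv :: "(real \<Rightarrow> real) \<Rightarrow> (real \<Rightarrow> real)" where
  "wderiv u = (SOME w. w \<in> L2 \<and> has_weak_deriv u w)"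

definition action :: "nat \<Rightarrow> real \<Rightarrow> real \<Rightarrow> real \<Rightarrow> real \<Rightarrow> (real \<Rightarrow> real) \<Rightarrow> (real \<Rightarrow> real) \<Rightarrow> real" where
  "action k a b c d u v =
     1/2 * (integral\<^sup>L lborel (\<lambda>x. (u x)^2) + integral\<^sup>L lborel (\<lambda>x. (v x)^2))
   + 1/2 * (integral\<^sup>L lborel (\<lambda>x. (wderiv u x)^2) + integral\<^sup>L lborel (\<lambda>x. (wderiv v x)^2))
   - integral\<^sup>L lborel (\<lambda>x. HH k a b c d (u x) (v x))"

text \<open>Weak solution of the system (equivalently, critical point of the action).\<close>

definition weak_solution :: "nat \<Rightarrow> real \<Rightarrow> real \<Rightarrow> real \<Rightarrow> real \<Rightarrow> (real \<Rightarrow> real) \<Rightarrow> (real \<Rightarrow> real) \<Rightarrow> bool" where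
  "weak_solution k a b c d \<phi> \<psi> \<longleftrightarrow> \<phi> \<in> H1 \<and> \<psi> \<in> H1 \<and>
     (\<forall>w\<in>H1. integral\<^sup>L lborel (\<lambda>x. \<phi> x * w x + wderiv \<phi> x * wderiv w x
                                   - ff k a b c d (\<phi> x) (\<psi> x) * w x) = 0) \<and>
     (\<forall>z\<in>H1. integral\<^sup>L lborel (\<lambda>x. \<psi> x * z x + wderiv \<psi> x * wderiv z x
                                   - gg k a b c d (\<phi> x) (\<psi> x) * z x) = 0)"

text \<open>(u,v) is the zero element of H^1 x H^1, i.e. vanishes almost everywhere.\<close>

definition is_zero_pair :: "(real \<Rightarrow> real) \<Rightarrow> (real \<Rightarrow> real) \<Rightarrow> bool" where
  "is_zero_pair u v \<longleftrightarrow> (AE x in lborel. u x = 0 \<and> v x = 0)"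

definition ground_state :: "nat \<Rightarrow> real \<Rightarrow> real \<Rightarrow> real \<Rightarrow> real \<Rightarrow> (real \<Rightarrow> real) \<Rightarrow> (real \<Rightarrow> real) \<Rightarrow> bool" where
  "ground_state k a b c d \<phi> \<psi> \<longleftrightarrow>
     weak_solution k a b c d \<phi> \<psi> \<and> \<not> is_zero_pair \<phi> \<psi> \<and>
     action k a b c d \<phi> \<psi> =
       Inf {action k a b c d u v | u v. \<not> is_zero_pair u v \<and> weak_solution k a b c d u v}"

end

theory Submission
  imports Defs
begin

text \<open>
  Let $p = 2k+2$ be the degree of homogeneity of $H$ and let $M$ be the maximum of $H$ on the unit
  circle, attained at $(\<alpha>, \<beta>)$. By the Lagrange multiplier rule
  $\nabla H(\<alpha>, \<beta>) = p M (\<alpha>, \<beta>)$, so $(\<alpha> \<phi>, \<beta> \<phi>)$ is a solution for the scalar soliton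
  $\<phi>(x) = R \cosh(kx)^{-1/k}$ with $2 M R^{2k} = 1$. It is a ground state by a calibration argument.
  For a nontrivial weak solution $U$ the Nehari identity and Bernoulli's inequality give
  $I(U) \ge I(tU)$ for every $t$. Choose $t$ such that $\sup |tU| = R$. With
  $K'(z) = \frac12 \sqrt{1 - 2Mz^k}$, Young's inequality bounds the derivative of $K(|tU|^2)$ by
  $\frac12 |tU'|^2 + \frac12 |tU|^2 - M |tU|^p$, whose integral is at most $I(tU)$. Going from
  $0$ up to $R$ and back to $0$ therefore costs at least $2(K(R^2) - K(0))$, and this is the action
  of the soliton, for which Young's inequality is an equality. The chain rule applies because weak
  solutions are continuously differentiable, by the du Bois-Reymond lemma used twice.
\<close>

section \<open>Smooth functions and bump functions\<close>

text \<open>The candidate is explicit, so the work is a lower bound for every nontrivial weak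
  solution, with no decay, sign or symmetry known and with data defined only almost everywhere
  (\<open>wderiv\<close> is a choice by \<open>SOME\<close>). Calibration gives it without a
  compactness argument or a classification of solutions. K comes from the first integral of the
  soliton: \<phi>'^2 = \<phi>^2 - 2 M \<phi>^(2k+2), that is, |\<phi>'| = \<phi> sqrt(1 - 2 M z^k)
  with z = \<phi>^2. Along the soliton the density 1/2 \<phi>'^2 + 1/2 \<phi>^2 - M \<phi>^(2k+2)
  equals \<phi>'^2, and K'(z) |z'| = \<phi>'^2 forces K'(z) = |\<phi>'| / (2 \<phi>). The amplitude
  R is the turning point where this root vanishes. Since R^2 is also the last z at which the root is
  real, tU has to reach R and must not exceed it. The condition a + b + c + d > 0 makes M positive.
  If all four coefficients vanish, testing the equations with the solution itself shows that it is
  zero, so there is no ground state.\<close>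

fun Ck :: "nat \<Rightarrow> (real \<Rightarrow> real) \<Rightarrow> bool" where
  "Ck 0 f = (\<forall>x. f differentiable (at x))"
| "Ck (Suc n) f = ((\<forall>x. f differentiable (at x)) \<and> Ck n (deriv f))"

lemma Ck_differentiable: "Ck n f \<Longrightarrow> f differentiable (at x)"
  by (cases n) auto

lemma Ck_DERIV: "Ck n f \<Longrightarrow> (f has_real_derivative deriv f x) (at x)"
  by (meson Ck_differentiable DERIV_deriv_iff_real_differentiable)

lemma Ck_lower: "Ck (Suc n) f \<Longrightarrow> Ck n f"
  by (induction n arbitrary: f) auto

lemma Ck_SucI:
  assumes "\<And>x. (f has_real_derivative f' x) (at x)" "Ck n f'"
  shows "Ck (Suc n) f"
proof -
  have "deriv f = f'" using assms(1) by (auto intro: DERIV_imp_deriv)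
  then show ?thesis using assms by (auto simp: real_differentiable_def)
qed

lemma Ck_0I: "(\<And>x. (f has_real_derivative f' x) (at x)) \<Longrightarrow> Ck 0 f"
  by (auto simp: real_differentiable_def)

lemma Ck_const: "Ck n (\<lambda>x. c)"
  by (induction n arbitrary: c) (auto intro!: Ck_SucI derivative_eq_intros)

lemma Ck_add: "Ck n f \<Longrightarrow> Ck n g \<Longrightarrow> Ck n (\<lambda>x. f x + g x)"
proof (induction n arbitrary: f g)
  case (Suc n)
  show ?case
    by (rule Ck_SucI[OF DERIV_add[OF Ck_DERIV[OF Suc.prems(1)] Ck_DERIV[OF Suc.prems(2)]]])
       (use Suc in auto)
qed auto

lemma Ck_mult: "Ck n f \<Longrightarrow> Ck n g \<Longrightarrow> Ck n (\<lambda>x. f x * g x)"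
proof (induction n arbitrary: f g)
  case (Suc n)
  show ?case
  proof (rule Ck_SucI)
    show "((\<lambda>x. f x * g x) has_real_derivative deriv f x * g x + deriv g x * f x) (at x)" for x
      by (rule DERIV_mult[OF Ck_DERIV[OF Suc.prems(1)] Ck_DERIV[OF Suc.prems(2)]])
    show "Ck n (\<lambda>x. deriv f x * g x + deriv g x * f x)"
      using Suc.prems Ck_lower by (intro Ck_add Suc.IH) auto
  qed
qed auto

lemma Ck_cmult: "Ck n f \<Longrightarrow> Ck n (\<lambda>x. c * f x)"
  using Ck_mult[OF Ck_const] by simp

lemma Ck_affine: "Ck n f \<Longrightarrow> Ck n (\<lambda>x. f (m * x + c))"
proof (induction n arbitrary: f)
  case 0
  have "((\<lambda>x. f (m * x + c)) has_real_derivative deriv f (m * x + c) * m) (at x)" for x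
    by (rule DERIV_chain2[OF Ck_DERIV[OF 0]]) (auto intro!: derivative_eq_intros)
  then show ?case by (rule Ck_0I)
next
  case (Suc n)
  show ?case
  proof (rule Ck_SucI)
    show "((\<lambda>x. f (m * x + c)) has_real_derivative m * deriv f (m * x + c)) (at x)" for x
      by (rule DERIV_chain2[OF Ck_DERIV[OF Suc.prems], THEN DERIV_cong])
         (auto intro!: derivative_eq_intros)
    show "Ck n (\<lambda>x. m * deriv f (m * x + c))"
      using Suc by (intro Ck_cmult Suc.IH) auto
  qed
qed

text \<open>Connects \<open>test_fun\<close>, which iterates \<open>deriv\<close> from outside, with
  \<open>Ck\<close>, which peels one derivative off the function itself and so allows inductions
  over arbitrary functions, as for products. The index is shifted: \<open>Ck n\<close> is
  differentiability of order n + 1.\<close>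

lemma Ck_iff: "(\<forall>n. Ck n f) \<longleftrightarrow> (\<forall>n x. ((deriv ^^ n) f) differentiable (at x))"
proof -
  have 1: "Ck n f \<Longrightarrow> (deriv ^^ n) f differentiable (at x)" for n f x
    by (induction n arbitrary: f) (auto simp: funpow_swap1)
  have 2: "(\<forall>m x. (deriv ^^ m) f differentiable (at x)) \<Longrightarrow> Ck n f" for n f
  proof (induction n arbitrary: f)
    case 0
    show ?case using spec[OF 0, of 0] by simp
  next
    case (Suc n)
    have "(deriv ^^ m) (deriv f) differentiable (at x)" for m x
      using Suc.prems[rule_format, of "Suc m" x] by (simp add: funpow_swap1)
    then show ?case using Suc.IH Suc.prems[rule_format, of 0] by simp
  qed
  show ?thesis using 1 2 by blast
qed

section \<open>Smooth functions that are flat at 0\<close>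

lemma tendsto_poly_div_exp_0: "((\<lambda>y. poly p y / exp y) \<longlongrightarrow> (0::real)) at_top"
proof -
  have "((\<lambda>y. \<Sum>i\<le>degree p. coeff p i * (y ^ i / exp y)) \<longlongrightarrow> (\<Sum>i\<le>degree p. coeff p i * 0)) at_top"
    by (intro tendsto_intros tendsto_power_div_exp_0)
  then show ?thesis by (simp add: poly_altdef sum_divide_distrib)
qed

text \<open>The functions $P(1/x) e^{-1/x}$, extended by $0$ to $x \le 0$, form a class closed under
  differentiation.\<close>

definition flat :: "real poly \<Rightarrow> real \<Rightarrow> real" where
  "flat p x = (if x > 0 then poly p (1/x) * exp (- 1/x) else 0)"

text \<open>With y = 1/x, the chain rule factor is -y^2, so p(y) e^(-y) has derivative y^2 (p -
  p')(y) e^(-y). This is the polynomial on the right; only x = 0 needs a limit.\<close>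

lemma flat_DERIV: "(flat p has_real_derivative flat (monom 1 2 * (p - pderiv p)) x) (at x)"
proof -
  consider "x > 0" | "x < 0" | "x = 0" by linarith
  then show ?thesis
  proof cases
    case 1
    have inv: "((\<lambda>x. 1/x) has_real_derivative - (1/x\<^sup>2)) (at x)"
      using 1 by (auto intro!: derivative_eq_intros simp: power2_eq_square)
    have "((\<lambda>x. exp (- (1/x))) has_real_derivative exp (- (1/x)) * (1/x\<^sup>2)) (at x)"
      using DERIV_fun_exp[OF DERIV_minus[OF inv]] by simp
    from DERIV_mult[OF DERIV_chain2[OF poly_DERIV inv] this]
    have "((\<lambda>x. poly p (1/x) * exp (- (1/x))) has_real_derivative
        flat (monom 1 2 * (p - pderiv p)) x) (at x)"
      using 1 by (simp add: flat_def poly_monom power_one_over algebra_simps)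
    then show ?thesis
      by (rule has_field_derivative_transform_within_open[of _ _ _ "{0<..}"]) (use 1 in \<open>auto simp: flat_def\<close>)
  next
    case 2
    have "((\<lambda>x. 0) has_real_derivative flat (monom 1 2 * (p - pderiv p)) x) (at x)"
      using 2 by (simp add: flat_def)
    then show ?thesis
      by (rule has_field_derivative_transform_within_open[of _ _ _ "{..<0}"]) (use 2 in \<open>auto simp: flat_def\<close>)
  next
    case 3
    \<comment> \<open>From the right, substitute h = 1/y: the quotient becomes y p(y) / exp y, and
      \<open>pCons 0 p\<close> is the polynomial y p(y).\<close>
    have "((\<lambda>h. flat p h / h) \<longlongrightarrow> 0) (at 0)"
    proof (rule filterlim_split_at)
      have "\<forall>\<^sub>F h in at_left 0. flat p h / h = 0"
        by (auto simp: eventually_at_filter flat_def)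
      then show "((\<lambda>h. flat p h / h) \<longlongrightarrow> 0) (at_left 0)"
        by (rule tendsto_eventually)
      have "\<forall>\<^sub>F y in at_top. poly (pCons 0 p) y / exp y = flat p (inverse y) / inverse y"
        using eventually_gt_at_top[of "0::real"]
        by eventually_elim (simp add: flat_def exp_minus divide_simps)
      then have "((\<lambda>y. flat p (inverse y) / inverse y) \<longlongrightarrow> 0) at_top"
        by (rule Lim_transform_eventually[OF tendsto_poly_div_exp_0[of "pCons 0 p"]])
      then show "((\<lambda>h. flat p h / h) \<longlongrightarrow> 0) (at_right 0)"
        by (simp add: filterlim_at_right_to_top)
    qed
    then show ?thesis using 3 by (simp add: DERIV_def flat_def)
  qed
qed

lemma Ck_flat: "Ck n (flat p)"
proof (induction n arbitrary: p)
  case 0 show ?case by (rule Ck_0I, rule flat_DERIV)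
next
  case (Suc n) show ?case by (rule Ck_SucI[OF flat_DERIV Suc])
qed

section \<open>Test functions and approximate indicators\<close>

lemma test_fun_iff: "test_fun \<phi> \<longleftrightarrow> (\<forall>n. Ck n \<phi>) \<and> (\<exists>N. \<forall>x. \<bar>x\<bar> > N \<longrightarrow> \<phi> x = 0)"
proof -
  have "bounded {x. \<phi> x \<noteq> 0} \<longleftrightarrow> (\<exists>N. \<forall>x. \<bar>x\<bar> > N \<longrightarrow> \<phi> x = 0)"
    by (auto simp: bounded_iff not_le[symmetric])
  then show ?thesis by (simp add: test_fun_def Ck_iff compact_closure)
qed

lemma test_funE:
  assumes "test_fun \<phi>"
  obtains N where "N > 0" "\<And>x. \<bar>x\<bar> \<ge> N \<Longrightarrow> \<phi> x = 0" "\<And>x. \<bar>x\<bar> \<ge> N \<Longrightarrow> deriv \<phi> x = 0"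
    "\<And>x. (\<phi> has_real_derivative deriv \<phi> x) (at x)" "continuous_on UNIV (deriv \<phi>)"
    "continuous_on UNIV \<phi>"
proof -
  from assms obtain M where M: "\<And>n. Ck n \<phi>" "\<And>x. \<bar>x\<bar> > M \<Longrightarrow> \<phi> x = 0"
    unfolding test_fun_iff by blast
  \<comment> \<open>The margin 1 puts every point with |x| at least \<open>?N\<close> inside an open
    set on which \<phi> vanishes, so the derivative vanishes there too.\<close>
  let ?N = "\<bar>M\<bar> + 1"
  have "deriv \<phi> x = 0" if "\<bar>x\<bar> \<ge> ?N" for x
  proof -
    have "((\<lambda>x. 0) has_real_derivative 0) (at x)" by simp
    then have "(\<phi> has_real_derivative 0) (at x)"
      by (rule has_field_derivative_transform_within_open[of _ _ _ "{..< - \<bar>M\<bar>} \<union> {\<bar>M\<bar> <..}"])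
         (use that M(2) in \<open>auto simp: abs_if split: if_splits\<close>)
    then show ?thesis by (rule DERIV_imp_deriv)
  qed
  moreover have "\<And>x. (\<phi> has_real_derivative deriv \<phi> x) (at x)" using Ck_DERIV M(1) by blast
  moreover have "Ck 0 (deriv \<phi>)" using M(1)[of "Suc 0"] by simp
  then have "continuous_on UNIV (deriv \<phi>)"
    by (meson Ck_DERIV DERIV_isCont continuous_at_imp_continuous_on)
  moreover have "continuous_on UNIV \<phi>"
    by (meson M(1) Ck_DERIV DERIV_isCont continuous_at_imp_continuous_on)
  ultimately show ?thesis using that[of ?N] M(2) by auto
qed

lemma test_fun_lincomb:
  assumes "test_fun \<phi>" "test_fun \<psi>"
  shows "test_fun (\<lambda>x. \<phi> x + c * \<psi> x)"
proof -
  obtain N1 N2 where "\<And>x. \<bar>x\<bar> > N1 \<Longrightarrow> \<phi> x = 0" "\<And>x. \<bar>x\<bar> > N2 \<Longrightarrow> \<psi> x = 0"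
    using assms unfolding test_fun_iff by blast
  then have "\<forall>x. \<bar>x\<bar> > max N1 N2 \<longrightarrow> \<phi> x + c * \<psi> x = 0" by auto
  then show ?thesis using assms unfolding test_fun_iff by (intro conjI allI exI[of _ "max N1 N2"] Ck_add Ck_cmult) auto
qed

text \<open>Inside (a, b) the value is exp(-1/((n+1)(x-a))) exp(-1/((n+1)(b-x))), which increases to
  1 with n. The bumps therefore approach the indicator from below, with no normalisation or
  mollifier.\<close>

definition bump :: "real \<Rightarrow> real \<Rightarrow> nat \<Rightarrow> real \<Rightarrow> real" where
  "bump a b n x = flat 1 (real (Suc n) * (x - a)) * flat 1 (real (Suc n) * (b - x))"

lemma test_fun_bump: "test_fun (bump a b n)"
proof -
  have "Ck m (\<lambda>x. flat 1 (Suc n * x + (- (Suc n * a))) * flat 1 (- Suc n * x + Suc n * b))" for m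
    by (intro Ck_mult Ck_affine Ck_flat)
  then have "Ck m (bump a b n)" for m
    by (simp add: bump_def[abs_def] algebra_simps)
  moreover have "\<bar>x\<bar> > \<bar>a\<bar> + \<bar>b\<bar> \<Longrightarrow> bump a b n x = 0" for x
    by (auto simp: bump_def flat_def zero_less_mult_iff)
  ultimately show ?thesis unfolding test_fun_iff by blast
qed

lemma bump_nonneg: "bump a b n x \<ge> 0" by (auto simp: bump_def flat_def)

lemma bump_le_indicator: "bump a b n x \<le> indicator {a<..<b} x"
  by (auto simp: bump_def flat_def indicator_def zero_less_mult_iff mult_le_one)

lemma bump_pos: "a < x \<Longrightarrow> x < b \<Longrightarrow> bump a b n x > 0"
  by (auto simp: bump_def flat_def)

lemma bump_tendsto: "(\<lambda>n. bump a b n x) \<longlonglongrightarrow> indicator {a<..<b} x"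
proof (cases "a < x \<and> x < b")
  case True
  have "(\<lambda>n. - (inverse (real (Suc n)) * (1 / c))) \<longlonglongrightarrow> - (0 * (1/c))" for c
    by (intro tendsto_intros LIMSEQ_inverse_real_of_nat)
  then have *: "(\<lambda>n. exp (- (inverse (real (Suc n)) * (1 / c)))) \<longlonglongrightarrow> exp 0" for c
    by (intro tendsto_intros) auto
  have "(\<lambda>n. exp (- (inverse (real (Suc n)) * (1 / (x - a)))) * exp (- (inverse (real (Suc n)) * (1 / (b - x))))) \<longlonglongrightarrow> exp 0 * exp 0"
    by (intro tendsto_mult *)
  then show ?thesis
    using True by (simp add: bump_def flat_def divide_simps del: of_nat_Suc)
next
  case False
  then have "bump a b n x = 0" for n by (auto simp: bump_def flat_def zero_less_mult_iff)
  then show ?thesis using False by (auto simp: indicator_def)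
qed

section \<open>The du Bois-Reymond lemmas\<close>

text \<open>A common home for L2 functions and for continuous functions without known decay, such as
  the right-hand side of the equation; both can be paired with test functions.\<close>

definition loc_integrable :: "(real \<Rightarrow> real) \<Rightarrow> bool" where
  "loc_integrable w \<longleftrightarrow> w \<in> borel_measurable lborel \<and> (\<forall>a b. set_integrable lborel {a..b} w)"

lemma loc_integrable_cont: "continuous_on UNIV g \<Longrightarrow> loc_integrable g"
  unfolding loc_integrable_def
  by (auto intro!: borel_integrable_atLeastAtMost' borel_measurable_continuous_onI intro: continuous_on_subset)

lemma loc_integrable_bound:
  assumes "f \<in> borel_measurable lborel" "loc_integrable h" "AE x in lborel. \<bar>f x\<bar> \<le> h x"
  shows "loc_integrable f"
  unfolding loc_integrable_def
proof (intro conjI allI assms)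
  fix a b :: real
  have "set_integrable lborel {a..b} h" using assms by (simp add: loc_integrable_def)
  moreover have "(\<lambda>x. indicator {a..b} x *\<^sub>R f x) \<in> borel_measurable lborel"
    using assms(1) by measurable
  ultimately show "set_integrable lborel {a..b} f" unfolding set_integrable_def
    by (rule Bochner_Integration.integrable_bound) (use assms(3) in \<open>eventually_elim, auto simp: indicator_def\<close>)
qed

lemma L2_integrable_mult:
  assumes "u \<in> L2" "v \<in> L2"
  shows "integrable lborel (\<lambda>x. u x * v x)"
proof (rule Bochner_Integration.integrable_bound)
  show "integrable lborel (\<lambda>x. (u x)\<^sup>2 + (v x)\<^sup>2)" using assms by (auto simp: L2_def)
  show "(\<lambda>x. u x * v x) \<in> borel_measurable lborel" using assms by (auto simp: L2_def)
  have "\<bar>s * t\<bar> \<le> s\<^sup>2 + t\<^sup>2" for s t :: real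
  proof -
    have "2 * (\<bar>s\<bar> * \<bar>t\<bar>) \<le> s\<^sup>2 + t\<^sup>2"
      using sum_squares_bound[of "\<bar>s\<bar>" "\<bar>t\<bar>"] by simp
    moreover have "0 \<le> \<bar>s\<bar> * \<bar>t\<bar>" by simp
    ultimately show ?thesis unfolding abs_mult by linarith
  qed
  then show "AE x in lborel. norm (u x * v x) \<le> norm ((u x)\<^sup>2 + (v x)\<^sup>2)" by auto
qed

lemma loc_integrable_add:
  assumes "loc_integrable u" "loc_integrable v"
  shows "loc_integrable (\<lambda>x. u x + v x)"
  using assms by (auto simp: loc_integrable_def intro: borel_measurable_add)

lemma loc_integrable_diff:
  assumes "loc_integrable u" "loc_integrable v"
  shows "loc_integrable (\<lambda>x. u x - v x)"
  using assms by (auto simp: loc_integrable_def intro: borel_measurable_diff)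

lemma loc_integrable_abs:
  assumes "loc_integrable u"
  shows "loc_integrable (\<lambda>x. \<bar>u x\<bar>)"
  using assms by (auto simp: loc_integrable_def set_integrable_abs)

lemma loc_integrable_integrable: "integrable lborel f \<Longrightarrow> loc_integrable f"
  using integrable_mult_indicator[of _ lborel f] by (auto simp: loc_integrable_def set_integrable_def)

lemma L2_loc_integrable:
  assumes "u \<in> L2"
  shows "loc_integrable u"
proof (rule loc_integrable_bound)
  show "u \<in> borel_measurable lborel" using assms by (simp add: L2_def)
  show "loc_integrable (\<lambda>x. (u x)\<^sup>2 + 1)"
    using assms by (intro loc_integrable_add loc_integrable_integrable loc_integrable_cont) (auto simp: L2_def)
  have "\<bar>s\<bar> \<le> s\<^sup>2 + 1" for s :: real
    using sum_squares_bound[of "\<bar>s\<bar>" 1] by simp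
  then show "AE x in lborel. \<bar>u x\<bar> \<le> (u x)\<^sup>2 + 1" by simp
qed

lemma loc_integrable_mult_cont:
  assumes w: "loc_integrable w" and g: "continuous_on UNIV g"
  shows "loc_integrable (\<lambda>x. w x * g x)"
  unfolding loc_integrable_def
proof (intro conjI allI)
  have [measurable]: "w \<in> borel_measurable borel" "g \<in> borel_measurable borel"
    using w g by (auto simp: loc_integrable_def intro: borel_measurable_continuous_onI)
  show "(\<lambda>x. w x * g x) \<in> borel_measurable lborel" by measurable
  fix a b :: real
  have "compact (g ` {a..b})"
    by (intro compact_continuous_image) (auto intro: continuous_on_subset[OF g])
  then obtain B where B: "\<And>x. x \<in> {a..b} \<Longrightarrow> \<bar>g x\<bar> \<le> B"
    using compact_imp_bounded by (force simp: bounded_iff)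
  have "integrable lborel (\<lambda>x. B * (indicator {a..b} x *\<^sub>R w x))"
    using w by (intro integrable_mult_right) (auto simp: loc_integrable_def set_integrable_def)
  then show "set_integrable lborel {a..b} (\<lambda>x. w x * g x)" unfolding set_integrable_def
  proof (rule Bochner_Integration.integrable_bound)
    have "\<bar>w x\<bar> * \<bar>g x\<bar> \<le> \<bar>B\<bar> * \<bar>w x\<bar>" if "x \<in> {a..b}" for x
      using mult_left_mono[of "\<bar>g x\<bar>" "\<bar>B\<bar>" "\<bar>w x\<bar>"] B[OF that] by (simp add: mult.commute)
    then show "AE x in lborel. norm (indicator {a..b} x *\<^sub>R (w x * g x)) \<le> norm (B * (indicator {a..b} x *\<^sub>R w x))"
      by (auto simp: indicator_def abs_mult)
  qed measurable
qed

lemma loc_integrable_integrable_on: "loc_integrable w \<Longrightarrow> w integrable_on {a..b}"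
  using set_borel_integral_eq_integral(1) by (auto simp: loc_integrable_def)

lemma integral_compact_support:
  assumes w: "loc_integrable w" and 0: "\<And>x. \<bar>x\<bar> \<ge> N \<Longrightarrow> w x = 0"
  shows "integrable lborel w" "integral\<^sup>L lborel w = integral {-N..N} w"
proof -
  have *: "indicator {-N..N} x *\<^sub>R w x = w x" for x
    using 0[of x] by (cases "\<bar>x\<bar> \<ge> N") (auto simp: indicator_def)
  have s: "set_integrable lborel {-N..N} w" using w by (simp add: loc_integrable_def)
  show "integrable lborel w" using s unfolding set_integrable_def * .
  show "integral\<^sup>L lborel w = integral {-N..N} w"
    using set_borel_integral_eq_integral(2)[OF s] unfolding set_lebesgue_integral_def * .
qed

lemma integrable_mult_test:
  assumes "loc_integrable w" "test_fun \<phi>"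
  shows "integrable lborel (\<lambda>x. w x * \<phi> x)" "integrable lborel (\<lambda>x. w x * deriv \<phi> x)"
  using assms
  by (auto elim!: test_funE intro!: integral_compact_support(1)[OF loc_integrable_mult_cont])

text \<open>The Borel sets over which f integrates to 0 contain the closed intervals and are closed
  under disjoint countable unions and, by \<open>z'\<close>, under complements. Hence they are all
  Borel sets, and f and 0 are equal as densities.\<close>

lemma AE_zero_of_integral_Icc:
  fixes f :: "real \<Rightarrow> real"
  assumes f: "integrable lborel f" and z: "\<And>a b. a \<le> b \<Longrightarrow> (LINT x:{a..b}|lborel. f x) = 0"
    and z': "integral\<^sup>L lborel f = 0"
  shows "AE x in lborel. f x = 0"
proof -
  have si: "set_integrable lborel A f" if "A \<in> sets lborel" for A
    using integrable_mult_indicator[OF that f] by (simp add: set_integrable_def)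
  have "(LINT x:A|lborel. f x) = 0" if "A \<in> sets borel" for A
    using that
  proof (induction rule: borel_set_induct)
    case empty show ?case by (simp add: set_lebesgue_integral_def)
  next
    case (interval a b) then show ?case using z by blast
  next
    case (compl A)
    have "(LINT x:(A \<union> - A)|lborel. f x) = (LINT x:A|lborel. f x) + (LINT x:-A|lborel. f x)"
      using compl by (intro set_integral_Un si) auto
    then show ?case using compl z' set_integral_space[OF f] by simp
  next
    case (union F)
    have "(LINT x:(\<Union>i. F i)|lborel. f x) = (\<Sum>i. (LINT x:(F i)|lborel. f x))"
      using union by (intro lebesgue_integral_countable_add si) (auto simp: disjoint_family_on_def)
    then show ?case using union by simp
  qed
  then have "AE x in lborel. f x = (0::real)"
    by (intro density_unique_real f) auto
  then show ?thesis .
qed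

text \<open>Testing with bumps and passing to the limit by dominated convergence shows that w
  integrates to 0 over every compact interval.\<close>

lemma du_Bois_Reymond_zero:
  assumes w: "loc_integrable w" and z: "\<And>\<phi>. test_fun \<phi> \<Longrightarrow> integral\<^sup>L lborel (\<lambda>x. w x * \<phi> x) = 0"
  shows "AE x in lborel. w x = 0"
proof -
  have [measurable]: "w \<in> borel_measurable borel" using w by (simp add: loc_integrable_def)
  have 1: "(LINT x:{a..b}|lborel. w x) = 0" for a b
  proof -
    have [measurable]: "bump a b n \<in> borel_measurable borel" for n
      using test_fun_bump[of a b n] by (auto elim!: test_funE intro: borel_measurable_continuous_onI)
    have "(\<lambda>n. integral\<^sup>L lborel (\<lambda>x. w x * bump a b n x)) \<longlonglongrightarrow> integral\<^sup>L lborel (\<lambda>x. indicator {a..b} x *\<^sub>R w x)"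
    proof (rule integral_dominated_convergence)
      show "integrable lborel (\<lambda>x. indicator {a..b} x *\<^sub>R \<bar>w x\<bar>)"
        using loc_integrable_abs[OF w] by (simp add: loc_integrable_def set_integrable_def)
      have lim: "(\<lambda>n. w x * bump a b n x) \<longlonglongrightarrow> w x * indicator {a<..<b} x" for x
        by (intro tendsto_intros bump_tendsto)
      \<comment> \<open>The bumps converge to the indicator of the open interval; the two endpoints
        are a null set.\<close>
      have "AE x in lborel. x \<noteq> a \<and> x \<noteq> b"
        using AE_lborel_singleton[of a] AE_lborel_singleton[of b] by eventually_elim simp
      then have "AE x in lborel. w x * indicator {a<..<b} x = indicator {a..b} x *\<^sub>R w x"
        by eventually_elim (auto simp: indicator_def)
      then show "AE x in lborel. (\<lambda>n. w x * bump a b n x) \<longlonglongrightarrow> indicator {a..b} x *\<^sub>R w x"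
        by eventually_elim (use lim in metis)
      have "\<bar>w x\<bar> * \<bar>bump a b n x\<bar> \<le> indicator {a..b} x * \<bar>w x\<bar>" for n x
        using mult_left_mono[OF bump_le_indicator[of a b n x], of "\<bar>w x\<bar>"] bump_nonneg[of a b n x]
        by (cases "a < x \<and> x < b") (auto simp: indicator_def intro: order_trans)
      then show "AE x in lborel. norm (w x * bump a b n x) \<le> indicator {a..b} x *\<^sub>R \<bar>w x\<bar>" for n
        by (simp add: abs_mult)
    qed measurable
    then show ?thesis using z[OF test_fun_bump] LIMSEQ_unique[OF _ tendsto_const[of 0]]
      by (simp add: set_lebesgue_integral_def)
  qed
  \<comment> \<open>Truncation, because w is integrable only on bounded intervals; countably many
    null sets are united afterwards.\<close>
  have "AE x in lborel. indicator {- real n..real n} x * w x = 0" for n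
  proof (rule AE_zero_of_integral_Icc)
    show "integrable lborel (\<lambda>x. indicator {- real n..real n} x * w x)"
      using w by (simp add: loc_integrable_def set_integrable_def)
    show "integral\<^sup>L lborel (\<lambda>x. indicator {- real n..real n} x * w x) = 0"
      using 1[of "- real n" "real n"] by (simp add: set_lebesgue_integral_def)
    fix a b :: real
    have eq: "indicator {a..b} x * (indicator {- real n..real n} x * w x) = indicator {max a (- real n)..min b (real n)} x * w x" for x
      by (auto simp: indicator_def)
    then show "(LINT x:{a..b}|lborel. indicator {- real n..real n} x * w x) = 0"
      using 1[of "max a (- real n)" "min b (real n)"]
      unfolding set_lebesgue_integral_def real_scaleR_def eq by blast
  qed
  then have "AE x in lborel. \<forall>n. indicator {- real n..real n} x * w x = 0"
    unfolding AE_all_countable by blast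
  then show ?thesis
  proof eventually_elim
    case (elim x)
    obtain n where "\<bar>x\<bar> \<le> real n" using real_arch_simple by blast
    then show ?case using elim[rule_format, of n] by (auto simp: indicator_def split: if_splits)
  qed
qed

lemma continuous_antiderivative:
  fixes f :: "real \<Rightarrow> real"
  assumes "continuous_on UNIV f"
  obtains F where "\<And>x. (F has_real_derivative f x) (at x)"
proof -
  have "isCont f x" for x using assms by (simp add: continuous_on_eq_continuous_at)
  then have "\<exists>F. \<forall>x::real. - \<infinity> < ereal x \<longrightarrow> ereal x < \<infinity> \<longrightarrow> (F has_vector_derivative f x) (at x)"
    by (intro einterval_antiderivative) auto
  then show ?thesis using that by (auto simp: has_real_derivative_iff_has_vector_derivative)
qed

lemma FTC_real:
  fixes f :: "real \<Rightarrow> real"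
  assumes "\<And>x. (F has_real_derivative f x) (at x)" "a \<le> b"
  shows "integral {a..b} f = F b - F a"
  using assms by (intro integral_unique fundamental_theorem_of_calculus)
    (auto simp: has_real_derivative_iff_has_vector_derivative[symmetric] intro: has_field_derivative_at_within)

text \<open>The antiderivative normalised to 0 at -N returns to 0 at N exactly because the integral
  of \<psi> vanishes; this gives it compact support.\<close>

lemma test_fun_antiderivative:
  assumes \<psi>: "test_fun \<psi>" and z: "integral\<^sup>L lborel \<psi> = 0"
  obtains \<phi> where "test_fun \<phi>" "deriv \<phi> = \<psi>"
proof -
  obtain N where N: "N > 0" "\<And>x. \<bar>x\<bar> \<ge> N \<Longrightarrow> \<psi> x = 0" and c: "continuous_on UNIV \<psi>"
    using \<psi> by (elim test_funE) blast
  obtain F where F: "\<And>x. (F has_real_derivative \<psi> x) (at x)"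
    using continuous_antiderivative[OF c] by blast
  define \<phi> where "\<phi> x = F x - F (-N)" for x
  have D: "(\<phi> has_real_derivative \<psi> x) (at x)" for x
    unfolding \<phi>_def[abs_def] by (auto intro!: derivative_eq_intros F)
  have int0: "integral {a..b} \<psi> = 0" if "b \<le> -N \<or> a \<ge> N" for a b
  proof -
    have "integral {a..b} \<psi> = integral {a..b} (\<lambda>x. 0)"
      by (rule integral_cong) (use that N in auto)
    then show ?thesis by simp
  qed
  have NN: "F N = F (-N)"
    using integral_compact_support(2)[OF loc_integrable_cont[OF c] N(2)] z FTC_real[OF F, of "-N" N] N(1)
    by simp
  have "\<phi> x = 0" if x: "\<bar>x\<bar> > N" for x
  proof (cases "x > 0")
    case True
    then show ?thesis using FTC_real[OF F, of N x] int0[of x N] x NN by (simp add: \<phi>_def)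
  next
    case False
    then show ?thesis using FTC_real[OF F, of x "-N"] int0[of "-N" x] x NN by (simp add: \<phi>_def)
  qed
  moreover have "Ck n \<phi>" for n
  proof -
    have "Ck (Suc n) \<phi>" using \<psi> by (intro Ck_SucI[OF D]) (simp add: test_fun_iff)
    then show ?thesis by (rule Ck_lower)
  qed
  ultimately have "test_fun \<phi>" unfolding test_fun_iff by blast
  moreover have "deriv \<phi> = \<psi>" using D by (auto intro: DERIV_imp_deriv)
  ultimately show ?thesis using that by blast
qed

lemma test_fun_integrable: "test_fun \<phi> \<Longrightarrow> integrable lborel \<phi>"
  using integrable_mult_test(1)[OF loc_integrable_cont[of "\<lambda>_. 1"]] by simp

text \<open>Subtracting J / I times the fixed bump \<open>?\<theta>\<close> from a test function
  \<psi> gives mean zero, hence the derivative of a test function, which v annihilates. So v - c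
  annihilates every \<psi>, where c is the average of v with weight
  \<open>?\<theta>\<close>.\<close>

lemma du_Bois_Reymond_const:
  assumes v: "loc_integrable v" and z: "\<And>\<phi>. test_fun \<phi> \<Longrightarrow> integral\<^sup>L lborel (\<lambda>x. v x * deriv \<phi> x) = 0"
  obtains c where "AE x in lborel. v x = c"
proof -
  let ?\<theta> = "bump 0 1 0"
  define I where "I = integral\<^sup>L lborel ?\<theta>"
  define c where "c = integral\<^sup>L lborel (\<lambda>x. v x * ?\<theta> x) / I"
  have "I \<noteq> 0"
  proof
    assume "I = 0"
    then have "AE x in lborel. ?\<theta> x = 0"
      unfolding I_def by (subst (asm) integral_nonneg_eq_0_iff_AE) (auto simp: bump_nonneg test_fun_integrable test_fun_bump)
    then have "AE x in lborel. x \<notin> {0<..<1::real}"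
      by eventually_elim (use bump_pos[of 0 _ 1 0] in force)
    then have "{0<..<1::real} \<in> null_sets lborel"
      using AE_iff_null_sets[of "{0<..<1::real}" lborel] by auto
    then show False by (auto simp: null_sets_def)
  qed
  have "AE x in lborel. v x - c = 0"
  proof (rule du_Bois_Reymond_zero)
    show "loc_integrable (\<lambda>x. v x - c)" by (intro loc_integrable_diff v loc_integrable_cont) auto
    fix \<psi> assume \<psi>: "test_fun \<psi>"
    define J where "J = integral\<^sup>L lborel \<psi>"
    have t: "test_fun (\<lambda>x. \<psi> x + (- J / I) * ?\<theta> x)"
      by (rule test_fun_lincomb[OF \<psi> test_fun_bump])
    have "integral\<^sup>L lborel (\<lambda>x. \<psi> x + (- J / I) * ?\<theta> x) = J + (- J / I) * I"
      using \<psi> test_fun_bump by (subst Bochner_Integration.integral_add)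
        (auto simp: J_def I_def test_fun_integrable)
    then have "integral\<^sup>L lborel (\<lambda>x. \<psi> x + (- J / I) * ?\<theta> x) = 0" using \<open>I \<noteq> 0\<close> by simp
    from test_fun_antiderivative[OF t this] obtain \<phi> where
      "test_fun \<phi>" "deriv \<phi> = (\<lambda>x. \<psi> x + (- J / I) * ?\<theta> x)" by blast
    with z[of \<phi>] have "0 = integral\<^sup>L lborel (\<lambda>x. v x * (\<psi> x + (- J / I) * ?\<theta> x))" by simp
    also have "\<dots> = integral\<^sup>L lborel (\<lambda>x. v x * \<psi> x + (- J / I) * (v x * ?\<theta> x))"
      by (simp add: algebra_simps)
    also have "\<dots> = integral\<^sup>L lborel (\<lambda>x. v x * \<psi> x) + (- J / I) * integral\<^sup>L lborel (\<lambda>x. v x * ?\<theta> x)"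
      using integrable_mult_test(1)[OF v \<psi>] integrable_mult_test(1)[OF v test_fun_bump]
      by (subst Bochner_Integration.integral_add) auto
    also have "\<dots> = integral\<^sup>L lborel (\<lambda>x. v x * \<psi> x) - c * J"
      by (simp add: c_def)
    also have "\<dots> = integral\<^sup>L lborel (\<lambda>x. v x * \<psi> x - c * \<psi> x)"
      using integrable_mult_test(1)[OF v \<psi>] test_fun_integrable[OF \<psi>]
      by (subst Bochner_Integration.integral_diff) (auto simp: J_def)
    finally show "integral\<^sup>L lborel (\<lambda>x. (v x - c) * \<psi> x) = 0" by (simp add: algebra_simps)
  qed
  then show ?thesis using that[of c] by simp
qed

section \<open>Absolutely continuous representatives\<close>

text \<open>Absolute continuity with density w, expressed by increments: w is known only almost
  everywhere, so no pointwise derivative can be demanded. \<open>integral\<close> is the gauge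
  integral.\<close>

definition primitive :: "(real \<Rightarrow> real) \<Rightarrow> (real \<Rightarrow> real) \<Rightarrow> bool" where
  "primitive F w \<longleftrightarrow> (\<forall>x y. x \<le> y \<longrightarrow> F y - F x = integral {x..y} w)"

lemma primitive_DERIV:
  assumes "\<And>x. (F has_real_derivative f x) (at x)"
  shows "primitive F f"
  using FTC_real[OF assms] by (simp add: primitive_def)

lemma primitive_exists:
  assumes w: "loc_integrable w"
  obtains F where "primitive F w"
proof
  let ?F = "\<lambda>x. if 0 \<le> x then integral {0..x} w else - integral {x..0} w"
  have c: "x \<le> y \<Longrightarrow> y \<le> z \<Longrightarrow> integral {x..y} w + integral {y..z} w = integral {x..z} w" for x y z
    by (intro Henstock_Kurzweil_Integration.integral_combine loc_integrable_integrable_on[OF w])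
  show "primitive ?F w"
    unfolding primitive_def
  proof (intro allI impI)
    fix x y :: real assume "x \<le> y"
    then show "?F y - ?F x = integral {x..y} w"
      using c[of 0 x y] c[of x 0 y] c[of x y 0] by (auto simp: not_le)
  qed
qed

lemma primitive_cont:
  assumes w: "loc_integrable w" and F: "primitive F w"
  shows "continuous_on UNIV F"
proof -
  have "continuous_on {a..b} F" for a b
  proof -
    have "continuous_on {a..b} (\<lambda>x. F a + integral {a..x} w)"
      by (intro continuous_intros indefinite_integral_continuous_1 loc_integrable_integrable_on w)
    moreover have "F a + integral {a..x} w = F x" if "x \<in> {a..b}" for x
      using F that unfolding primitive_def by (metis atLeastAtMost_iff add.commute diff_add_cancel)
    ultimately show ?thesis by (simp cong: continuous_on_cong_simp)
  qed
  then have "isCont F x" for x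
    using continuous_on_interior[of "{x-1..x+1}" F x] by simp
  then show ?thesis by (simp add: continuous_on_eq_continuous_at)
qed

lemma primitive_cong_AE:
  assumes F: "primitive F w" and w: "loc_integrable w" "loc_integrable w'" and ae: "AE x in lborel. w x = w' x"
  shows "primitive F w'"
proof -
  have "integral {x..y} w = integral {x..y} w'" for x y
  proof -
    have "(LINT t:{x..y}|lborel. w t) = (LINT t:{x..y}|lborel. w' t)"
      unfolding set_lebesgue_integral_def using w
      by (intro integral_cong_AE) (use ae in \<open>auto simp: loc_integrable_def\<close>)
    moreover have "set_integrable lborel {x..y} w" "set_integrable lborel {x..y} w'"
      using w by (simp_all add: loc_integrable_def)
    ultimately show ?thesis using set_borel_integral_eq_integral(2) by metis
  qed
  then show ?thesis using F by (simp add: primitive_def)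
qed

lemma primitive_by_parts:
  assumes w: "loc_integrable w" and F: "primitive F w"
    and g: "\<And>x. (g has_real_derivative g' x) (at x)" "continuous_on UNIV g'" and ab: "a \<le> b"
  shows "integral {a..b} (\<lambda>x. F x * g' x + w x * g x) = F b * g b - F a * g a"
proof -
  let ?h = "\<lambda>x. F x * g' x + w x * g x"
  have cF: "continuous_on UNIV F" by (rule primitive_cont[OF w F])
  have cg: "continuous_on UNIV g"
    using g(1) by (meson DERIV_isCont continuous_at_imp_continuous_on)
  have lh: "loc_integrable ?h"
    by (intro loc_integrable_add loc_integrable_mult_cont w cg loc_integrable_cont continuous_intros cF g)
  have comb: "integral {x..y} w + integral {y..z} w = integral {x..z} w"
    if "x \<le> y" "y \<le> z" "loc_integrable w" for x y z w
    using that by (intro Henstock_Kurzweil_Integration.integral_combine loc_integrable_integrable_on)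
  define D where "D x = integral {a..x} ?h - F x * g x" for x
  define W where "W x = integral {a..x} (\<lambda>x. \<bar>w x\<bar>)" for x
  have cW: "continuous_on {a..b} W"
    unfolding W_def by (intro indefinite_integral_continuous_1 loc_integrable_integrable_on loc_integrable_abs w)
  have "compact (g' ` {a..b})"
    by (intro compact_continuous_image) (auto intro: continuous_on_subset[OF g(2)])
  then obtain C where C: "\<And>x. x \<in> {a..b} \<Longrightarrow> \<bar>g' x\<bar> \<le> C"
    using compact_imp_bounded by (force simp: bounded_iff)
  have C0: "C \<ge> 0" using C[of a] ab by auto
  have *: "\<bar>D y - D x\<bar> \<le> 2 * C * (y - x) * (W y - W x)" if xy: "a \<le> x" "x \<le> y" "y \<le> b" for x y
  proof -
    let ?V = "integral {x..y} (\<lambda>x. \<bar>w x\<bar>)"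
    have V: "W y - W x = ?V"
      using comb[OF xy(1,2) loc_integrable_abs[OF w]] by (simp add: W_def)
    have Fdiff: "F t - F s = integral {s..t} w" if "s \<le> t" for s t
      using F that by (simp add: primitive_def)
    have gdiff: "g t - g s = integral {s..t} g'" if "s \<le> t" for s t
      using FTC_real[OF g(1) that] by simp
    have li: "loc_integrable (\<lambda>t. (F t - F x) * g' t + w t * (g t - g y))"
      by (intro loc_integrable_add loc_integrable_mult_cont w loc_integrable_cont continuous_intros cF cg g)
    have l1: "loc_integrable (\<lambda>t. w t * g y)" "loc_integrable (\<lambda>t. F x * g' t)"
      by (intro loc_integrable_mult_cont w loc_integrable_cont continuous_intros g)+
    have "D y - D x = integral {x..y} ?h - (F y * g y - F x * g x)"
      using comb[OF xy(1,2) lh] by (simp add: D_def)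
    \<comment> \<open>Expanded at F x and at g y, so that both terms of the remaining integrand
      contain a small factor: F t - F x and g t - g y.\<close>
    also have "F y * g y - F x * g x = (F y - F x) * g y + F x * (g y - g x)"
      by (simp add: algebra_simps)
    also have "\<dots> = integral {x..y} (\<lambda>t. w t * g y) + integral {x..y} (\<lambda>t. F x * g' t)"
      using Fdiff[OF xy(2)] gdiff[OF xy(2)] by simp
    also have "\<dots> = integral {x..y} (\<lambda>t. w t * g y + F x * g' t)"
      by (intro Henstock_Kurzweil_Integration.integral_add[symmetric] loc_integrable_integrable_on l1)
    also have "integral {x..y} ?h - \<dots> = integral {x..y} (\<lambda>t. ?h t - (w t * g y + F x * g' t))"
      by (intro Henstock_Kurzweil_Integration.integral_diff[symmetric] loc_integrable_integrable_on lh loc_integrable_add l1)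
    also have "\<dots> = integral {x..y} (\<lambda>t. (F t - F x) * g' t + w t * (g t - g y))"
      by (simp add: algebra_simps)
    finally have eq: "D y - D x = integral {x..y} (\<lambda>t. (F t - F x) * g' t + w t * (g t - g y))" .
    \<comment> \<open>The first term is constant in t and the second a multiple of |w|. Over [x, y]
      each integrates to C (y - x) \<open>?V\<close>, hence the factor 2 C.\<close>
    have b: "\<bar>(F t - F x) * g' t + w t * (g t - g y)\<bar> \<le> ?V * C + C * (y - x) * \<bar>w t\<bar>" if t: "t \<in> {x..y}" for t
    proof -
      have "\<bar>F t - F x\<bar> \<le> integral {x..t} (\<lambda>x. \<bar>w x\<bar>)"
        using t integral_norm_bound_integral[of w "{x..t}" "\<lambda>x. \<bar>w x\<bar>"] Fdiff[of x t]
        by (auto intro: loc_integrable_integrable_on w loc_integrable_abs)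
      also have "\<dots> \<le> ?V"
        using comb[of x t y "\<lambda>x. \<bar>w x\<bar>"] t loc_integrable_abs[OF w]
          Henstock_Kurzweil_Integration.integral_nonneg[OF loc_integrable_integrable_on[OF loc_integrable_abs[OF w]], of t y] by auto
      finally have F1: "\<bar>F t - F x\<bar> \<le> ?V" .
      have "\<bar>integral {t..y} g'\<bar> \<le> C * (y - t)"
        using t xy C integral_norm_bound_integral[of g' "{t..y}" "\<lambda>x. C"]
        by (auto intro: loc_integrable_integrable_on loc_integrable_cont g simp: mult.commute)
      also have "\<dots> \<le> C * (y - x)" using C0 t by (intro mult_left_mono) auto
      finally have G1: "\<bar>g t - g y\<bar> \<le> C * (y - x)" using gdiff[of t y] t by auto
      have "\<bar>F t - F x\<bar> * \<bar>g' t\<bar> \<le> ?V * C"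
        using F1 C[of t] t xy by (intro mult_mono) auto
      moreover have "\<bar>w t\<bar> * \<bar>g t - g y\<bar> \<le> \<bar>w t\<bar> * (C * (y - x))"
        using G1 by (intro mult_left_mono) auto
      ultimately show ?thesis
        using abs_triangle_ineq[of "(F t - F x) * g' t" "w t * (g t - g y)"]
        by (simp add: abs_mult mult.commute)
    qed
    have lr: "(\<lambda>t. C * (y - x) * \<bar>w t\<bar>) integrable_on {x..y}"
      by (intro integrable_on_mult_right loc_integrable_integrable_on loc_integrable_abs w)
    have "\<bar>D y - D x\<bar> \<le> integral {x..y} (\<lambda>t. ?V * C + C * (y - x) * \<bar>w t\<bar>)"
      unfolding eq real_norm_def[symmetric]
      by (rule integral_norm_bound_integral[OF loc_integrable_integrable_on[OF li]])
         (use b lr in \<open>auto intro!: Henstock_Kurzweil_Integration.integrable_add\<close>)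
    also have "\<dots> = integral {x..y} (\<lambda>t. ?V * C) + integral {x..y} (\<lambda>t. C * (y - x) * \<bar>w t\<bar>)"
      using lr by (intro Henstock_Kurzweil_Integration.integral_add) auto
    also have "\<dots> = 2 * C * (y - x) * ?V"
    proof -
      have "integral {x..y} (\<lambda>t. C * (y - x) * \<bar>w t\<bar>) = C * (y - x) * ?V" by simp
      moreover have "integral {x..y} (\<lambda>t. ?V * C) = (y - x) * (?V * C)" using xy(2) by simp
      ultimately show ?thesis by (simp only: algebra_simps)
    qed
    finally show ?thesis by (simp add: V)
  qed
  have "(D has_field_derivative 0) (at x within {a..b})" if x: "x \<in> {a..b}" for x
    unfolding has_field_derivative_iff
  proof (rule Lim_null_comparison)
    have "(W \<longlongrightarrow> W x) (at x within {a..b})" using cW x by (simp add: continuous_on_def)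
    then have "((\<lambda>y. 2 * C * \<bar>W y - W x\<bar>) \<longlongrightarrow> 2 * C * \<bar>W x - W x\<bar>) (at x within {a..b})"
      by (intro tendsto_intros)
    then show "((\<lambda>y. 2 * C * \<bar>W y - W x\<bar>) \<longlongrightarrow> 0) (at x within {a..b})" by simp
    have "norm ((D y - D x) / (y - x)) \<le> 2 * C * \<bar>W y - W x\<bar>" if y: "y \<in> {a..b}" "y \<noteq> x" for y
    proof -
      have "\<bar>D y - D x\<bar> \<le> 2 * C * \<bar>y - x\<bar> * \<bar>W y - W x\<bar>"
      proof (cases "x \<le> y")
        case True
        have "2 * C * (y - x) * (W y - W x) \<le> 2 * C * (y - x) * \<bar>W y - W x\<bar>"
          using True C0 by (intro mult_left_mono) auto
        then show ?thesis using *[of x y] x y True by auto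
      next
        case False
        have "2 * C * (x - y) * (W x - W y) \<le> 2 * C * (x - y) * \<bar>W y - W x\<bar>"
          using False C0 by (intro mult_left_mono) auto
        then show ?thesis using *[of y x] x y False by auto
      qed
      then show ?thesis using y by (simp add: divide_simps mult_ac)
    qed
    then show "\<forall>\<^sub>F y in at x within {a..b}. norm ((D y - D x) / (y - x)) \<le> 2 * C * \<bar>W y - W x\<bar>"
      by (simp add: eventually_at_filter)
  qed
  then have "\<exists>c. \<forall>x\<in>{a..b}. D x = c" by (intro has_field_derivative_zero_constant) auto
  then have "D b = D a" using ab by auto
  then show ?thesis by (simp add: D_def)
qed

lemma primitive_weak_deriv:
  assumes w: "loc_integrable w" and F: "primitive F w"
  shows "has_weak_deriv F w"
  unfolding has_weak_deriv_def
proof (intro allI impI)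
  fix \<phi> assume t: "test_fun \<phi>"
  then obtain N where N: "N > 0" "\<And>x. \<bar>x\<bar> \<ge> N \<Longrightarrow> \<phi> x = 0" "\<And>x. \<bar>x\<bar> \<ge> N \<Longrightarrow> deriv \<phi> x = 0"
    "\<And>x. (\<phi> has_real_derivative deriv \<phi> x) (at x)" "continuous_on UNIV (deriv \<phi>)"
    "continuous_on UNIV \<phi>" by (elim test_funE) blast
  have lF: "loc_integrable F" by (intro loc_integrable_cont primitive_cont[OF w F])
  have l: "loc_integrable (\<lambda>x. F x * deriv \<phi> x + w x * \<phi> x)"
    by (intro loc_integrable_add loc_integrable_mult_cont lF w N)
  have "integral\<^sup>L lborel (\<lambda>x. F x * deriv \<phi> x) + integral\<^sup>L lborel (\<lambda>x. w x * \<phi> x) =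
      integral\<^sup>L lborel (\<lambda>x. F x * deriv \<phi> x + w x * \<phi> x)"
    by (intro Bochner_Integration.integral_add[symmetric] integrable_mult_test t w lF)
  also have "\<dots> = integral {-N..N} (\<lambda>x. F x * deriv \<phi> x + w x * \<phi> x)"
    using N by (intro integral_compact_support l) auto
  also have "\<dots> = F N * \<phi> N - F (-N) * \<phi> (-N)"
    using N by (intro primitive_by_parts w F) auto
  also have "\<dots> = 0" using N by simp
  finally show "integral\<^sup>L lborel (\<lambda>x. F x * deriv \<phi> x) = - integral\<^sup>L lborel (\<lambda>x. w x * \<phi> x)"
    by simp
qed

lemma weak_deriv_unique:
  assumes "loc_integrable w" "loc_integrable w'" "has_weak_deriv u w" "has_weak_deriv u w'"
  shows "AE x in lborel. w x = w' x"
proof -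
  have "AE x in lborel. w x - w' x = 0"
  proof (rule du_Bois_Reymond_zero[OF loc_integrable_diff[OF assms(1,2)]])
    fix \<phi> assume t: "test_fun \<phi>"
    have "integral\<^sup>L lborel (\<lambda>x. w x * \<phi> x) = integral\<^sup>L lborel (\<lambda>x. w' x * \<phi> x)"
      using assms(3,4) t unfolding has_weak_deriv_def by force
    then show "integral\<^sup>L lborel (\<lambda>x. (w x - w' x) * \<phi> x) = 0"
      using integrable_mult_test(1)[OF assms(1) t] integrable_mult_test(1)[OF assms(2) t]
      by (simp add: left_diff_distrib)
  qed
  then show ?thesis by simp
qed

text \<open>u and any primitive of w have the same weak derivative, so they differ by a constant
  almost everywhere; the constant is absorbed into F.\<close>

lemma weak_deriv_primitive:
  assumes u: "loc_integrable u" and w: "loc_integrable w" and d: "has_weak_deriv u w"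
  obtains F where "primitive F w" "AE x in lborel. u x = F x"
proof -
  obtain F where F: "primitive F w" using primitive_exists[OF w] .
  have lF: "loc_integrable F" by (intro loc_integrable_cont primitive_cont[OF w F])
  obtain c where "AE x in lborel. u x - F x = c"
  proof (rule du_Bois_Reymond_const[OF loc_integrable_diff[OF u lF]])
    fix \<phi> assume t: "test_fun \<phi>"
    have "integral\<^sup>L lborel (\<lambda>x. u x * deriv \<phi> x) = integral\<^sup>L lborel (\<lambda>x. F x * deriv \<phi> x)"
      using d primitive_weak_deriv[OF w F] t unfolding has_weak_deriv_def by force
    then show "integral\<^sup>L lborel (\<lambda>x. (u x - F x) * deriv \<phi> x) = 0"
      using integrable_mult_test(2)[OF u t] integrable_mult_test(2)[OF lF t]
      by (simp add: left_diff_distrib)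
  qed
  then have "AE x in lborel. u x = F x + c" by eventually_elim simp
  moreover have "primitive (\<lambda>x. F x + c) w" using F by (simp add: primitive_def)
  ultimately show ?thesis using that by blast
qed

section \<open>The space H1 and its chosen weak derivative\<close>

lemma H1_L2: "u \<in> H1 \<Longrightarrow> u \<in> L2"
  by (simp add: H1_def)

lemma wderiv_H1:
  assumes "u \<in> H1"
  shows "wderiv u \<in> L2" "has_weak_deriv u (wderiv u)"
proof -
  have "\<exists>w. w \<in> L2 \<and> has_weak_deriv u w" using assms by (auto simp: H1_def)
  from someI_ex[OF this] show "wderiv u \<in> L2" "has_weak_deriv u (wderiv u)"
    by (auto simp: wderiv_def)
qed

lemma H1_I: "u \<in> L2 \<Longrightarrow> w \<in> L2 \<Longrightarrow> has_weak_deriv u w \<Longrightarrow> u \<in> H1"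
  by (auto simp: H1_def)

text \<open>\<open>wderiv\<close> picks an arbitrary representative, so an explicit weak derivative
  can replace it only almost everywhere.\<close>

lemma wderiv_AE:
  assumes "u \<in> L2" "w \<in> L2" "has_weak_deriv u w"
  shows "AE x in lborel. wderiv u x = w x"
  using weak_deriv_unique[OF L2_loc_integrable L2_loc_integrable] wderiv_H1[OF H1_I[OF assms]] assms
  by blast

lemma H1_primitive:
  assumes "u \<in> H1"
  obtains F where "primitive F (wderiv u)" "AE x in lborel. u x = F x"
  using weak_deriv_primitive[OF L2_loc_integrable L2_loc_integrable wderiv_H1(2)] H1_L2 wderiv_H1(1) assms
  by metis

lemma test_fun_H1:
  assumes t: "test_fun \<phi>"
  shows "\<phi> \<in> H1" "AE x in lborel. wderiv \<phi> x = deriv \<phi> x"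
proof -
  from t obtain N where N: "\<And>x. (\<phi> has_real_derivative deriv \<phi> x) (at x)" "continuous_on UNIV (deriv \<phi>)"
    "continuous_on UNIV \<phi>" by (elim test_funE) blast
  have "\<phi> \<in> L2" "deriv \<phi> \<in> L2"
    using integrable_mult_test(1)[OF loc_integrable_cont[OF N(3)] t]
      integrable_mult_test(2)[OF loc_integrable_cont[OF N(2)] t] N
    by (auto simp: L2_def power2_eq_square intro: borel_measurable_continuous_onI)
  moreover have "has_weak_deriv \<phi> (deriv \<phi>)"
    by (intro primitive_weak_deriv loc_integrable_cont N primitive_DERIV)
  ultimately show "\<phi> \<in> H1" "AE x in lborel. wderiv \<phi> x = deriv \<phi> x"
    by (auto intro: H1_I wderiv_AE)
qed

section \<open>The homogeneous potential\<close>

lemma HH_homogeneous: "HH k a b c d (s * u) (s * v) = s ^ (2*k+2) * HH k a b c d u v"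
proof -
  define S where "S = s ^ (2*k+2)"
  have S: "S = s ^ (k+1) * s ^ (k+1)" "S = s ^ (k+2) * s ^ k"
    unfolding S_def power_add[symmetric] by (simp_all add: mult_2)
  have 1: "(s * x) ^ (2*k+2) = S * x ^ (2*k+2)" for x by (simp add: S_def power_mult_distrib)
  have 2: "(s * u * (s * v)) ^ (k+1) = S * (u * v) ^ (k+1)"
    by (simp only: S(1) power_mult_distrib ac_simps)
  have 3: "x * (s * u) ^ (k+2) * (s * v) ^ k = S * (x * u ^ (k+2) * v ^ k)"
    and 4: "x * (s * u) ^ k * (s * v) ^ (k+2) = S * (x * u ^ k * v ^ (k+2))" for x
    by (simp_all only: S(2) power_mult_distrib ac_simps)
  show ?thesis
    unfolding HH_def 1 2 3 4 S_def[symmetric] by (simp add: distrib_left mult.left_commute)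
qed

lemma ff_homogeneous: "k \<ge> 1 \<Longrightarrow> ff k a b c d (s * u) (s * v) = s ^ (2*k+1) * ff k a b c d u v"
  by (cases k) (simp_all add: ff_def power_mult_distrib power_add mult_2 mult_2_right algebra_simps)

lemma gg_homogeneous: "k \<ge> 1 \<Longrightarrow> gg k a b c d (s * u) (s * v) = s ^ (2*k+1) * gg k a b c d u v"
  by (cases k) (simp_all add: gg_def power_mult_distrib power_add mult_2 mult_2_right algebra_simps)

lemma HH_Euler:
  assumes "k \<ge> 1"
  shows "u * ff k a b c d u v + v * gg k a b c d u v = (2 * real k + 2) * HH k a b c d u v"
proof -
  obtain m where [simp]: "k = Suc m" using assms by (cases k) auto
  \<comment> \<open>Naming the five monomials reduces Euler's relation to an identity linear in
    them, with coefficients rational in k.\<close>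
  define A where "A = u ^ (2*k+2)"
  define B where "B = v ^ (2*k+2)"
  define C where "C = (u * v) ^ (k+1)"
  define D where "D = u ^ (k+2) * v ^ k"
  define E where "E = u ^ k * v ^ (k+2)"
  have 1: "u * ff k a b c d u v = a * A + b * C + (real k + 2) / real k * c * D + d * E"
    by (simp add: ff_def A_def C_def D_def E_def power_mult_distrib power_add mult_2 algebra_simps)
  have 2: "v * gg k a b c d u v = a * B + b * C + (real k + 2) / real k * d * E + c * D"
    by (simp add: gg_def B_def C_def D_def E_def power_mult_distrib power_add mult_2 algebra_simps)
  have 3: "HH k a b c d u v = a / (2 * real k + 2) * (A + B) + b / (real k + 1) * C + c / real k * D + d / real k * E"
    by (simp only: HH_def A_def B_def C_def D_def E_def mult.assoc)
  have "real k > 0" by simp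
  then have 4: "(2 * r + 2) * (a / (2 * r + 2) * (A + B) + b / (r + 1) * C + c / r * D + d / r * E)
     = a * A + b * C + (r + 2) / r * c * D + d * E + (a * B + b * C + (r + 2) / r * d * E + c * D)"
    if "r > 0" for r :: real
  proof -
    have "(2 * r + 2) * (a / (2 * r + 2) * (A + B)) = a * (A + B)" using that by simp
    moreover have "(2 * r + 2) * (b / (r + 1) * C) = 2 * b * C"
    proof -
      have "(2 * r + 2) * (b / (r + 1) * C) = 2 * ((r + 1) * (b / (r + 1))) * C"
        by (simp only: distrib_right mult.assoc mult_2 distrib_left mult_1)
      then show ?thesis using that by simp
    qed
    moreover have "(2 * r + 2) * (c / r * D) = (r + 2) / r * c * D + c * D" using that by (simp add: field_simps)
    moreover have "(2 * r + 2) * (d / r * E) = (r + 2) / r * d * E + d * E" using that by (simp add: field_simps)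
    ultimately show ?thesis unfolding distrib_left by linarith
  qed
  show ?thesis unfolding 1 2 3 using 4[OF \<open>real k > 0\<close>] by simp
qed

text \<open>Says that (\<open>ff\<close>, \<open>gg\<close>) is the gradient of \<open>HH\<close>.
  The form along a curve suffices, since H is differentiated only along the unit circle.\<close>

lemma HH_DERIV:
  assumes k: "k \<ge> 1" and x: "(x has_real_derivative x') (at t)" and y: "(y has_real_derivative y') (at t)"
  shows "((\<lambda>t. HH k a b c d (x t) (y t)) has_real_derivative
      ff k a b c d (x t) (y t) * x' + gg k a b c d (x t) (y t) * y') (at t)"
proof -
  obtain m where m: "k = Suc m" using k by (cases k) auto
  have P: "((\<lambda>t. x t ^ n) has_real_derivative real n * x t ^ (n - 1) * x') (at t)"
    "((\<lambda>t. y t ^ n) has_real_derivative real n * y t ^ (n - 1) * y') (at t)" for n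
    by (auto intro!: derivative_eq_intros x y)
  have Q: "((\<lambda>t. x t ^ i * y t ^ j) has_real_derivative
      (real i * x t ^ (i - 1) * y t ^ j) * x' + (real j * x t ^ i * y t ^ (j - 1)) * y') (at t)" for i j
    using DERIV_mult[OF P(1)[of i] P(2)[of j]] by (simp add: algebra_simps)
  have "((\<lambda>t. a / (2 * real k + 2) * (x t ^ (2*k+2) + y t ^ (2*k+2)) + b / (real k + 1) * (x t ^ (k+1) * y t ^ (k+1))
     + c / real k * (x t ^ (k+2) * y t ^ k) + d / real k * (x t ^ k * y t ^ (k+2))) has_real_derivative
     a / (2 * real k + 2) * (real (2*k+2) * x t ^ (2*k+2-1) * x' + real (2*k+2) * y t ^ (2*k+2-1) * y')
     + b / (real k + 1) * ((real (k+1) * x t ^ (k+1-1) * y t ^ (k+1)) * x' + (real (k+1) * x t ^ (k+1) * y t ^ (k+1-1)) * y')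
     + c / real k * ((real (k+2) * x t ^ (k+2-1) * y t ^ k) * x' + (real k * x t ^ (k+2) * y t ^ (k-1)) * y')
     + d / real k * ((real k * x t ^ (k-1) * y t ^ (k+2)) * x' + (real (k+2) * x t ^ k * y t ^ (k+2-1)) * y')) (at t)"
    by (intro DERIV_add DERIV_cmult P Q)
  moreover have "a / (2 * real k + 2) * (real (2*k+2) * x t ^ (2*k+2-1) * x' + real (2*k+2) * y t ^ (2*k+2-1) * y')
     + b / (real k + 1) * ((real (k+1) * x t ^ (k+1-1) * y t ^ (k+1)) * x' + (real (k+1) * x t ^ (k+1) * y t ^ (k+1-1)) * y')
     + c / real k * ((real (k+2) * x t ^ (k+2-1) * y t ^ k) * x' + (real k * x t ^ (k+2) * y t ^ (k-1)) * y')
     + d / real k * ((real k * x t ^ (k-1) * y t ^ (k+2)) * x' + (real (k+2) * x t ^ k * y t ^ (k+2-1)) * y')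
     = ff k a b c d (x t) (y t) * x' + gg k a b c d (x t) (y t) * y'"
  proof -
    have c1: "a / (2 * real k + 2) * (real (2*k+2) * X * x' + real (2*k+2) * Y * y') = a * X * x' + a * Y * y'" for X Y
    proof -
      have g: "q * (n * X * x' + n * Y * y') = (q * n) * (X * x' + Y * y')" for q n :: real
        by (simp add: algebra_simps)
      have "a / (2 * real k + 2) * (real (2*k+2) * X * x' + real (2*k+2) * Y * y')
        = (a / (2 * real k + 2) * real (2*k+2)) * (X * x' + Y * y')" by (rule g)
      also have "a / (2 * real k + 2) * real (2*k+2) = a"
      proof -
        have e: "real (2*k+2) = 2 * real k + 2" and "2 * real k + 2 > 0" by auto
        then show ?thesis unfolding e by simp
      qed
      finally show ?thesis by (simp add: algebra_simps)
    qed
    have c2: "b / (real k + 1) * (real (k+1) * X * Z * x' + real (k+1) * W * Y * y') = b * X * Z * x' + b * W * Y * y'" for X Y Z W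
    proof -
      have g: "q * (n * X * Z * x' + n * W * Y * y') = (q * n) * (X * Z * x' + W * Y * y')" for q n :: real
        by (simp add: algebra_simps)
      have e: "real (k+1) = real k + 1" and "real k + 1 > 0" by auto
      then have "b / (real k + 1) * real (k+1) = b" unfolding e by simp
      then show ?thesis unfolding g by (simp add: algebra_simps)
    qed
    have c3: "c / real k * (real (k+2) * X * Z * x' + real k * W * Y * y') = (real k + 2) / real k * c * X * Z * x' + c * W * Y * y'" for c X Y Z W x' y'
      using k by (simp add: field_simps)
    have c4: "d / real k * (real k * X * Z * x' + real (k+2) * W * Y * y') = d * X * Z * x' + (real k + 2) / real k * d * W * Y * y'" for d X Y Z W x' y'
      using k by (simp add: field_simps)
    show ?thesis unfolding c1 c2 c3 c4 ff_def gg_def by (simp add: algebra_simps)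
  qed
  ultimately show ?thesis unfolding HH_def power_mult_distrib mult.assoc by (simp add: mult.assoc)
qed

lemma abs_monomial_le:
  fixes u v s :: real
  assumes "\<bar>u\<bar> \<le> s" "\<bar>v\<bar> \<le> s"
  shows "\<bar>u ^ i * v ^ j\<bar> \<le> s ^ (i + j)"
  unfolding abs_mult power_abs power_add using assms
  by (intro mult_mono power_mono) auto

lemma ff_bound:
  assumes k: "k \<ge> 1" and nn: "a \<ge> 0" "b \<ge> 0" "c \<ge> 0" "d \<ge> 0" and s: "\<bar>u\<bar> \<le> s" "\<bar>v\<bar> \<le> s"
  shows "\<bar>ff k a b c d u v\<bar> \<le> (a + b + (real k + 2) / real k * c + d) * s ^ (2*k+1)"
proof -
  let ?e = "(real k + 2) / real k * c"
  have e: "?e \<ge> 0" using nn by simp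
  have "\<bar>x * t\<bar> \<le> x * S" if "x \<ge> 0" "\<bar>t\<bar> \<le> S" for x t S :: real
    using that by (simp add: abs_mult mult_left_mono)
  note * = this
  have 1: "\<bar>a * (u ^ (2*k+1) * v ^ 0)\<bar> \<le> a * s ^ (2*k+1 + 0)" "\<bar>b * (u ^ k * v ^ (k+1))\<bar> \<le> b * s ^ (k + (k+1))"
    "\<bar>?e * (u ^ (k+1) * v ^ k)\<bar> \<le> ?e * s ^ (k + 1 + k)" "\<bar>d * (u ^ (k-1) * v ^ (k+2))\<bar> \<le> d * s ^ (k - 1 + (k+2))"
    using nn e by (intro * abs_monomial_le s; simp)+
  \<comment> \<open>In the last exponent the subtraction is truncated; k at least 1 makes it
    genuine, so all four terms have degree 2k+1.\<close>
  have 2: "k + (k+1) = 2*k+1" "k + 1 + k = 2*k+1" "k - 1 + (k+2) = 2*k+1" using k by auto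
  have 3: "\<bar>w + x + y + z\<bar> \<le> (a + b + ?e + d) * S"
    if "\<bar>w\<bar> \<le> a * S" "\<bar>x\<bar> \<le> b * S" "\<bar>y\<bar> \<le> ?e * S" "\<bar>z\<bar> \<le> d * S" for w x y z S
    using that unfolding distrib_right by linarith
  show ?thesis using 3[OF 1[unfolded 2 add_0_right]] by (simp add: ff_def mult.assoc)
qed

text \<open>Exchanging the components together with c and d preserves the system, so facts about the
  first equation carry over to the second.\<close>

lemma gg_eq_ff: "gg k a b c d u v = ff k a b d c v u"
  by (simp add: ff_def gg_def)

text \<open>The multiplier rule is obtained from the angle: at the maximum the gradient has no
  tangential part, and Euler's relation gives its radial part (2k+2) M. Homogeneity extends the
  bound from the circle to the plane.\<close>

lemma HH_circle_maximum:
  assumes k: "k \<ge> 1" and nn: "a \<ge> 0" "b \<ge> 0" "c \<ge> 0" "d \<ge> 0" and pos: "a + b + c + d > 0"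
  obtains M \<alpha> \<beta> where "M > 0" "\<alpha>\<^sup>2 + \<beta>\<^sup>2 = 1" "\<And>u v. HH k a b c d u v \<le> M * (u\<^sup>2 + v\<^sup>2) ^ (k+1)"
    "ff k a b c d \<alpha> \<beta> = (2 * real k + 2) * M * \<alpha>" "gg k a b c d \<alpha> \<beta> = (2 * real k + 2) * M * \<beta>"
proof -
  let ?H = "HH k a b c d"
  define h where "h t = ?H (cos t) (sin t)" for t
  have D: "(h has_real_derivative ff k a b c d (cos t) (sin t) * (- sin t) + gg k a b c d (cos t) (sin t) * cos t) (at t)" for t
    unfolding h_def[abs_def] by (rule HH_DERIV[OF k]) (auto intro!: derivative_eq_intros)
  have "continuous_on {0..2*pi} h"
    using D by (meson DERIV_isCont continuous_at_imp_continuous_on)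
  then obtain t0 where t0: "\<And>t. t \<in> {0..2*pi} \<Longrightarrow> h t \<le> h t0"
    using continuous_attains_sup[of "{0..2*pi}" h] by fastforce
  define M where "M = h t0"
  have circ: "?H u v \<le> M" if uv: "u\<^sup>2 + v\<^sup>2 = 1" for u v
  proof -
    obtain t where "0 \<le> t" "t < 2*pi" "u = cos t" "v = sin t" using sincos_total_2pi[OF uv] .
    then show ?thesis using t0[of t] by (simp add: h_def M_def)
  qed
  have bound: "?H u v \<le> M * (u\<^sup>2 + v\<^sup>2) ^ (k+1)" for u v
  proof (cases "u = 0 \<and> v = 0")
    case True then show ?thesis using k by (simp add: HH_def)
  next
    case False
    define r where "r = sqrt (u\<^sup>2 + v\<^sup>2)"
    have r2: "r\<^sup>2 = u\<^sup>2 + v\<^sup>2" by (simp add: r_def)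
    have r: "r > 0" using False by (simp add: r_def sum_power2_gt_zero_iff)
    have "?H (r * (u/r)) (r * (v/r)) = r ^ (2*k+2) * ?H (u/r) (v/r)" by (rule HH_homogeneous)
    also have "\<dots> \<le> r ^ (2*k+2) * M"
    proof (intro mult_left_mono circ)
      show "(u / r)\<^sup>2 + (v / r)\<^sup>2 = 1"
        using r r2 False by (simp add: power_divide add_divide_distrib[symmetric])
    qed (use r in auto)
    also have "r ^ (2*k+2) = (r\<^sup>2) ^ (k+1)" by (subst power_mult[symmetric]) simp
    finally show ?thesis using r r2 by (simp add: mult.commute)
  qed
  \<comment> \<open>Here the positive coefficient sum enters: H(1, 1) is positive, which forces M >
    0.\<close>
  have "?H 1 1 > 0"
  proof -
    have "a / (2 * real k + 2) * 2 \<ge> 0" "b / (real k + 1) \<ge> 0" "c / real k \<ge> 0" "d / real k \<ge> 0" using nn by auto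
    moreover have "a / (2 * real k + 2) * 2 > 0 \<or> b / (real k + 1) > 0 \<or> c / real k > 0 \<or> d / real k > 0"
      using nn pos k by (auto simp: zero_less_divide_iff)
    moreover have "?H 1 1 = a / (2 * real k + 2) * 2 + b / (real k + 1) + c / real k + d / real k"
      by (simp add: HH_def)
    ultimately show ?thesis by linarith
  qed
  then have "0 < M * 2 ^ (k+1)" using bound[of 1 1] by simp
  then have M: "M > 0" by (simp add: zero_less_mult_iff)
  define \<alpha> where "\<alpha> = cos t0"
  define \<beta> where "\<beta> = sin t0"
  let ?f = "ff k a b c d \<alpha> \<beta>" and ?g = "gg k a b c d \<alpha> \<beta>"
  have one: "\<alpha>\<^sup>2 + \<beta>\<^sup>2 = 1" by (simp add: \<alpha>_def \<beta>_def)
  \<comment> \<open>\<open>circ\<close> bounds h by M on the whole line, so t0 is an interior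
    maximum even if it is an endpoint of the interval.\<close>
  have "?f * (- \<beta>) + ?g * \<alpha> = 0" unfolding \<alpha>_def \<beta>_def
    by (rule DERIV_local_max[OF D, of 1]) (use circ in \<open>auto simp: h_def M_def[symmetric, unfolded h_def]\<close>)
  moreover have "\<alpha> * ?f + \<beta> * ?g = (2 * real k + 2) * M"
    unfolding HH_Euler[OF k] by (simp add: M_def h_def \<alpha>_def \<beta>_def)
  \<comment> \<open>Expansion of (F, G) in the orthonormal frame (\<alpha>, \<beta>), (-\<beta>,
    \<alpha>).\<close>
  moreover have "F = P * \<alpha> \<and> G = P * \<beta>" if "F * (- \<beta>) + G * \<alpha> = 0" "\<alpha> * F + \<beta> * G = P" for F G P
  proof -
    have "F = F * (\<alpha>\<^sup>2 + \<beta>\<^sup>2)" "G = G * (\<alpha>\<^sup>2 + \<beta>\<^sup>2)" by (simp_all add: one)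
    moreover have "F * (\<alpha>\<^sup>2 + \<beta>\<^sup>2) = (\<alpha> * F + \<beta> * G) * \<alpha> - \<beta> * (F * (- \<beta>) + G * \<alpha>)"
      "G * (\<alpha>\<^sup>2 + \<beta>\<^sup>2) = (\<alpha> * F + \<beta> * G) * \<beta> + \<alpha> * (F * (- \<beta>) + G * \<alpha>)"
      by (simp_all add: algebra_simps power2_eq_square)
    ultimately show ?thesis using that by simp
  qed
  ultimately have "?f = (2 * real k + 2) * M * \<alpha> \<and> ?g = (2 * real k + 2) * M * \<beta>" by blast
  then show ?thesis using that[OF M one bound] by blast
qed

section \<open>Integrals over the line and the soliton\<close>

lemma integral_symmetric_Icc_tendsto:
  assumes f: "integrable lborel (f :: real \<Rightarrow> real)"
  shows "(\<lambda>n. integral {- real n..real n} f) \<longlonglongrightarrow> integral\<^sup>L lborel f"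
proof -
  have [measurable]: "f \<in> borel_measurable borel" using f by auto
  have eq: "integral {- real n..real n} f = integral\<^sup>L lborel (\<lambda>x. indicator {- real n..real n} x *\<^sub>R f x)" for n
    using set_borel_integral_eq_integral(2)[of "{- real n..real n}" f] loc_integrable_integrable[OF f]
    by (simp add: loc_integrable_def set_lebesgue_integral_def)
  show ?thesis unfolding eq
  proof (rule integral_dominated_convergence)
    show "integrable lborel (\<lambda>x. \<bar>f x\<bar>)" using f by simp
    have "(\<lambda>n. indicator {- real n..real n} x *\<^sub>R f x) \<longlonglongrightarrow> f x" for x
    proof (rule tendsto_eventually)
      obtain m where m: "\<bar>x\<bar> \<le> real m" using real_arch_simple by blast
      show "\<forall>\<^sub>F n in sequentially. indicator {- real n..real n} x *\<^sub>R f x = f x"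
        using eventually_ge_at_top[of m]
      proof eventually_elim
        case (elim n)
        then have "real m \<le> real n" by simp
        with m have "x \<in> {- real n..real n}" by auto
        then show ?case by simp
      qed
    qed
    then show "AE x in lborel. (\<lambda>n. indicator {- real n..real n} x *\<^sub>R f x) \<longlonglongrightarrow> f x" by simp
    show "AE x in lborel. norm (indicator {- real n..real n} x *\<^sub>R f x) \<le> \<bar>f x\<bar>" for n
      by (auto simp: indicator_def)
  qed measurable
qed

lemma integral_Icc_le:
  assumes f: "integrable lborel (f :: real \<Rightarrow> real)" and nn: "\<And>x. f x \<ge> 0"
  shows "integral {a..b} f \<le> integral\<^sup>L lborel f"
proof -
  have "integral {a..b} f = integral\<^sup>L lborel (\<lambda>x. indicator {a..b} x *\<^sub>R f x)"
    using set_borel_integral_eq_integral(2)[of "{a..b}" f] loc_integrable_integrable[OF f]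
    by (simp add: loc_integrable_def set_lebesgue_integral_def)
  also have "\<dots> \<le> integral\<^sup>L lborel f"
    using f nn by (intro integral_mono integrable_mult_indicator) (auto simp: indicator_def)
  finally show ?thesis .
qed

text \<open>If f exceeded the bound on the whole interval, its integral there would be at least the
  total integral plus 1. This averaging replaces any statement about decay at infinity.\<close>

lemma integrable_small_value:
  assumes F: "integrable lborel (f :: real \<Rightarrow> real)" and nn: "\<And>x. f x \<ge> 0" and h: "h > 0"
  obtains y where "y \<in> {x..x+h}" "f y \<le> (integral\<^sup>L lborel f + 1) / h"
proof -
  let ?c = "(integral\<^sup>L lborel f + 1) / h"
  have "\<exists>y\<in>{x..x+h}. f y \<le> ?c"
  proof (rule ccontr)
    assume "\<not> ?thesis"
    then have "integral {x..x+h} (\<lambda>_. ?c) \<le> integral {x..x+h} f"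
      using loc_integrable_integrable_on[OF loc_integrable_integrable[OF F]]
      by (intro integral_le) (auto simp: not_le intro: less_imp_le)
    also have "\<dots> \<le> integral\<^sup>L lborel f" by (rule integral_Icc_le[OF F nn])
    finally show False using h by simp
  qed
  then show ?thesis using that by blast
qed

lemma primitive_L2_bounded:
  assumes w: "w \<in> L2" and F2: "F \<in> L2" and F: "primitive F w"
  obtains B where "\<And>x. \<bar>F x\<bar> \<le> B"
proof
  fix x
  have iF: "integrable lborel (\<lambda>x. (F x)\<^sup>2)" and iw: "integrable lborel (\<lambda>x. (w x)\<^sup>2)"
    using F2 w by (auto simp: L2_def)
  have le: "\<bar>s\<bar> \<le> s\<^sup>2 + 1" for s :: real
    using sum_squares_bound[of "\<bar>s\<bar>" 1] by simp
  have lw: "loc_integrable w" by (rule L2_loc_integrable[OF w])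
  obtain y where y: "y \<in> {x..x+1}" "(F y)\<^sup>2 \<le> integral\<^sup>L lborel (\<lambda>x. (F x)\<^sup>2) + 1"
    using integrable_small_value[OF iF, of 1 x] by auto
  have "F y - F x = integral {x..y} w" using F y by (simp add: primitive_def)
  moreover have "norm (integral {x..y} w) \<le> integral {x..y} (\<lambda>t. (w t)\<^sup>2 + 1)"
    using le by (intro integral_norm_bound_integral loc_integrable_integrable_on lw loc_integrable_add
        loc_integrable_integrable[OF iw] loc_integrable_cont) auto
  moreover have "integral {x..y} (\<lambda>t. (w t)\<^sup>2 + 1) = integral {x..y} (\<lambda>t. (w t)\<^sup>2) + integral {x..y} (\<lambda>t. 1)"
    by (intro Henstock_Kurzweil_Integration.integral_add loc_integrable_integrable_on loc_integrable_integrable[OF iw]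
        loc_integrable_cont continuous_intros)
  moreover have "integral {x..y} (\<lambda>t. (w t)\<^sup>2) \<le> integral\<^sup>L lborel (\<lambda>x. (w x)\<^sup>2)"
    by (rule integral_Icc_le[OF iw]) simp
  \<comment> \<open>The 3 collects 1 from the choice of y, 1 from |F y| being at most (F y)^2 + 1,
    and 1 from the length of [x, y].\<close>
  ultimately show "\<bar>F x\<bar> \<le> integral\<^sup>L lborel (\<lambda>x. (F x)\<^sup>2) + integral\<^sup>L lborel (\<lambda>x. (w x)\<^sup>2) + 3"
    using y le[of "F y"] by auto
qed

lemma primitive_by_parts_UNIV:
  assumes w: "loc_integrable w" and F: "primitive F w"
    and g: "\<And>x. (g has_real_derivative g' x) (at x)" "continuous_on UNIV g'"
    and i: "integrable lborel (\<lambda>x. F x * g' x + w x * g x)"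
    and B: "\<And>x. \<bar>F x\<bar> \<le> B" and lim: "(g \<longlongrightarrow> 0) at_top" "(g \<longlongrightarrow> 0) at_bot"
  shows "integral\<^sup>L lborel (\<lambda>x. F x * g' x + w x * g x) = 0"
proof -
  have "(\<lambda>n. g (real n)) \<longlonglongrightarrow> 0"
    by (rule filterlim_compose[OF lim(1) filterlim_real_sequentially])
  moreover have "(\<lambda>n. g (- real n)) \<longlonglongrightarrow> 0"
    by (rule filterlim_compose[OF lim(2)])
       (rule filterlim_compose[OF filterlim_uminus_at_bot_at_top filterlim_real_sequentially])
  ultimately have "(\<lambda>n. B * \<bar>g (real n)\<bar> + B * \<bar>g (- real n)\<bar>) \<longlonglongrightarrow> B * \<bar>0\<bar> + B * \<bar>0\<bar>"
    by (intro tendsto_intros)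
  then have l: "(\<lambda>n. B * \<bar>g (real n)\<bar> + B * \<bar>g (- real n)\<bar>) \<longlonglongrightarrow> 0" by simp
  have "(\<lambda>n. integral {- real n..real n} (\<lambda>x. F x * g' x + w x * g x)) \<longlonglongrightarrow> 0"
  proof (rule Lim_null_comparison[OF _ l])
    have "\<bar>F x * g x\<bar> \<le> B * \<bar>g x\<bar>" for x
      using B[of x] by (simp add: abs_mult mult_right_mono)
    then show "\<forall>\<^sub>F n in sequentially. norm (integral {- real n..real n} (\<lambda>x. F x * g' x + w x * g x))
        \<le> B * \<bar>g (real n)\<bar> + B * \<bar>g (- real n)\<bar>"
      using primitive_by_parts[OF w F g]
      by (intro always_eventually allI) (simp, smt (verit))
  qed
  then show ?thesis using integral_symmetric_Icc_tendsto[OF i] LIMSEQ_unique by blast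
qed

lemma integrable_inverse_1_plus_square: "integrable lborel (\<lambda>x::real. inverse (1 + x\<^sup>2))"
proof -
  have "set_integrable lborel (einterval (-\<infinity>) \<infinity>) (\<lambda>x::real. inverse (1 + x\<^sup>2))"
  proof (rule interval_integral_FTC_nonneg(1))
    show "((arctan \<circ> real_of_ereal) \<longlongrightarrow> - (pi/2)) (at_right (-\<infinity>))"
      using tendsto_arctan_at_bot by (simp add: ereal_tendsto_simps)
    show "((arctan \<circ> real_of_ereal) \<longlongrightarrow> pi/2) (at_left \<infinity>)"
      using tendsto_arctan_at_top by (simp add: ereal_tendsto_simps)
    show "isCont (\<lambda>x::real. inverse (1 + x\<^sup>2)) x" for x
      by (intro continuous_intros) (metis add_pos_nonneg less_irrefl zero_le_power2 zero_less_one)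
  qed (auto intro: DERIV_arctan)
  then show ?thesis by (simp add: set_integrable_def)
qed

section \<open>The soliton profile: first integral, equation and decay\<close>

definition soliton :: "nat \<Rightarrow> real \<Rightarrow> real \<Rightarrow> real" where
  "soliton k R x = R * cosh (real k * x) powr (- 1 / real k)"

lemma soliton_pos: "R > 0 \<Longrightarrow> soliton k R x > 0"
  by (simp add: soliton_def)

lemma soliton_0: "soliton k R 0 = R"
  by (simp add: soliton_def)

lemma soliton_DERIV:
  assumes "k \<ge> 1"
  shows "(soliton k R has_real_derivative - soliton k R x * tanh (real k * x)) (at x)"
proof -
  have c: "cosh (real k * x) > 0" by (rule cosh_real_pos)
  have "((\<lambda>x. cosh (real k * x)) has_real_derivative sinh (real k * x) * real k) (at x)"
    by (auto intro!: derivative_eq_intros)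
  from DERIV_cmult[OF DERIV_powr[OF this c DERIV_const[of "- 1 / real k"]], of R]
  have "(soliton k R has_real_derivative R * (cosh (real k * x) powr (- 1 / real k) *
     (sinh (real k * x) * real k * (- 1 / real k) / cosh (real k * x)))) (at x)"
    unfolding soliton_def[abs_def] by simp
  then show ?thesis using assms by (simp add: soliton_def tanh_def algebra_simps)
qed

text \<open>The exponent -1/k becomes -2 in the power 2k, so the left side is 1/cosh^2. With s' = -s
  tanh(kx) this is the first integral s'^2 = s^2 - 2 M s^(2k+2).\<close>

lemma soliton_power:
  assumes k: "k \<ge> 1" and R: "2 * M * R ^ (2*k) = 1"
  shows "2 * M * soliton k R x ^ (2*k) = 1 - (tanh (real k * x))\<^sup>2"
proof -
  have c: "cosh (real k * x) > 0" by (rule cosh_real_pos)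
  have "(cosh (real k * x) powr (- 1 / real k)) ^ (2*k) = cosh (real k * x) powr (- 1 / real k * real (2*k))"
    using c by (simp add: powr_realpow[symmetric] powr_powr)
  also have "- 1 / real k * real (2*k) = - 2" using k by simp
  also have "cosh (real k * x) powr (- 2) = 1 / (cosh (real k * x))\<^sup>2"
    using c by (simp add: powr_minus_divide)
  finally have "2 * M * soliton k R x ^ (2*k) = (2 * M * R ^ (2*k)) * (1 / (cosh (real k * x))\<^sup>2)"
    by (simp add: soliton_def power_mult_distrib)
  also have "\<dots> = 1 - (tanh (real k * x))\<^sup>2"
  proof -
    have "(sinh (real k * x))\<^sup>2 = (cosh (real k * x))\<^sup>2 - 1" by (simp add: cosh_square_eq)
    then show ?thesis unfolding R using c by (simp add: tanh_def power_divide diff_divide_distrib)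
  qed
  finally show ?thesis .
qed

text \<open>Differentiation gives s'' = s - (k+1) s (1 - tanh^2). Replacing 1 - tanh^2 by 2 M s^(2k)
  produces the factor (2k+2) M, the same multiple that the gradient of H has at the maximum
  point.\<close>

lemma soliton_deriv_DERIV:
  assumes k: "k \<ge> 1" and R: "2 * M * R ^ (2*k) = 1"
  shows "((\<lambda>x. - soliton k R x * tanh (real k * x)) has_real_derivative
     soliton k R x - (2 * real k + 2) * M * soliton k R x ^ (2*k+1)) (at x)"
proof -
  let ?s = "soliton k R x" and ?t = "tanh (real k * x)"
  have "(tanh has_real_derivative 1 - ?t\<^sup>2) (at (real k * x))"
    using cosh_real_pos[of "real k * x"] by (auto intro!: derivative_eq_intros)
  then have "((\<lambda>x. tanh (real k * x)) has_real_derivative (1 - ?t\<^sup>2) * real k) (at x)"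
    by (rule DERIV_chain2) (auto intro!: derivative_eq_intros)
  from DERIV_mult[OF DERIV_minus[OF soliton_DERIV[OF k]] this]
  have "((\<lambda>x. - soliton k R x * tanh (real k * x)) has_real_derivative
     - (- ?s * ?t) * ?t + (1 - ?t\<^sup>2) * real k * - ?s) (at x)" .
  moreover have "- (- ?s * ?t) * ?t + (1 - ?t\<^sup>2) * real k * - ?s = ?s - (real k + 1) * ?s * (1 - ?t\<^sup>2)"
    by (simp add: algebra_simps power2_eq_square)
  also have "\<dots> = ?s - (2 * real k + 2) * M * ?s ^ (2*k+1)"
    unfolding soliton_power[OF k R, symmetric] by (simp add: algebra_simps)
  ultimately show ?thesis by simp
qed

text \<open>cosh(kx) is at least e^(k|x|)/2, so the profile decays like 2 |R| e^(-|x|). Its square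
  is then weakened to a rational majorant, integrable through arctan and tending to 0.\<close>

lemma soliton_sq_bound:
  assumes k: "k \<ge> 1"
  shows "(soliton k R x)\<^sup>2 \<le> 4 * R\<^sup>2 * inverse (1 + x\<^sup>2)"
proof -
  have "exp (real k * \<bar>x\<bar>) / 2 \<le> cosh (real k * \<bar>x\<bar>)"
    by (simp add: cosh_def)
  also have "\<dots> = cosh (real k * x)" by (cases "x \<ge> 0") auto
  finally have c: "exp (real k * \<bar>x\<bar>) / 2 \<le> cosh (real k * x)" .
  have "cosh (real k * x) powr (- 1 / real k) \<le> (exp (real k * \<bar>x\<bar>) / 2) powr (- 1 / real k)"
    using c k by (intro powr_mono2') auto
  also have "\<dots> = exp (- \<bar>x\<bar>) * 2 powr (1 / real k)"
  proof -
    have "real k * \<bar>x\<bar> * (- 1 / real k) = - \<bar>x\<bar>" using k by simp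
    moreover have "(2::real) powr (- 1 / real k) = inverse (2 powr (1 / real k))"
      using powr_minus[of "2::real" "1 / real k"] by simp
    ultimately show ?thesis
      by (subst powr_divide) (simp_all only: exp_powr_real divide_inverse inverse_inverse_eq exp_ge_zero zero_le_numeral)
  qed
  also have "(2::real) powr (1 / real k) \<le> 2 powr 1" using k by (intro powr_mono) auto
  finally have 1: "cosh (real k * x) powr (- 1 / real k) \<le> exp (- \<bar>x\<bar>) * 2" by simp
  have "1 + x\<^sup>2 \<le> (1 + \<bar>x\<bar>)\<^sup>2" by (simp add: power2_sum)
  also have "\<dots> \<le> (exp \<bar>x\<bar>)\<^sup>2" by (intro power_mono exp_ge_add_one_self) auto
  finally have 2: "1 + x\<^sup>2 \<le> (exp \<bar>x\<bar>)\<^sup>2" .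
  have "(cosh (real k * x) powr (- 1 / real k))\<^sup>2 \<le> (exp (- \<bar>x\<bar>) * 2)\<^sup>2"
    by (rule power_mono[OF 1]) simp
  also have "\<dots> = 4 * inverse ((exp \<bar>x\<bar>)\<^sup>2)" by (simp add: power_mult_distrib exp_minus power_inverse)
  also have "\<dots> \<le> 4 * inverse (1 + x\<^sup>2)"
    using 2 by (intro mult_left_mono le_imp_inverse_le) (auto simp: add_pos_nonneg)
  finally have "R\<^sup>2 * (cosh (real k * x) powr (- 1 / real k))\<^sup>2 \<le> R\<^sup>2 * (4 * inverse (1 + x\<^sup>2))"
    by (rule mult_left_mono) simp
  then show ?thesis by (simp add: soliton_def power_mult_distrib mult_ac)
qed

section \<open>The calibration\<close>

text \<open>Here s stands for t^2 and z for |tU|^2; if p and q are the derivatives of u and v, the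
  last factor on the left is z'. Young's inequality is applied to (T u) p and (T v) q. The inner
  absolute value makes K' continuous on the whole line, so that K exists globally; \<open>b\<close>
  removes it.\<close>

lemma calibration_pointwise:
  fixes u v p q s M z :: real
  assumes s: "s \<ge> 0" and z: "z = s * (u\<^sup>2 + v\<^sup>2)" and b: "2 * M * z ^ k \<le> 1"
  shows "\<bar>sqrt \<bar>1 - 2 * M * z ^ k\<bar> / 2 * (s * (2 * (u * p + v * q)))\<bar> \<le> s / 2 * (p\<^sup>2 + q\<^sup>2) + z / 2 - M * z ^ (k+1)"
proof -
  define T where "T = sqrt \<bar>1 - 2 * M * z ^ k\<bar>"
  have T2: "T\<^sup>2 = 1 - 2 * M * z ^ k" using b by (simp add: T_def)
  have y: "\<bar>(T * x) * w\<bar> \<le> (T\<^sup>2 * x\<^sup>2 + w\<^sup>2) / 2" for x w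
    using sum_squares_bound[of "\<bar>T * x\<bar>" "\<bar>w\<bar>"] by (simp add: abs_mult power_mult_distrib)
  have "\<bar>(T * u) * p + (T * v) * q\<bar> \<le> (T\<^sup>2 * u\<^sup>2 + p\<^sup>2) / 2 + (T\<^sup>2 * v\<^sup>2 + q\<^sup>2) / 2"
    using y[of u p] y[of v q] by linarith
  then have "s * \<bar>(T * u) * p + (T * v) * q\<bar> \<le> s * ((T\<^sup>2 * u\<^sup>2 + p\<^sup>2) / 2 + (T\<^sup>2 * v\<^sup>2 + q\<^sup>2) / 2)"
    by (rule mult_left_mono[OF _ s])
  also have "\<dots> = s / 2 * (p\<^sup>2 + q\<^sup>2) + T\<^sup>2 * z / 2" by (simp add: z field_simps)
  also have "\<dots> = s / 2 * (p\<^sup>2 + q\<^sup>2) + z / 2 - M * z ^ (k+1)" unfolding T2 by (simp add: field_simps)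
  also have "s * \<bar>(T * u) * p + (T * v) * q\<bar> = \<bar>T / 2 * (s * (2 * (u * p + v * q)))\<bar>"
  proof -
    have "T / 2 * (s * (2 * (u * p + v * q))) = s * ((T * u) * p + (T * v) * q)" by (simp add: algebra_simps)
    then show ?thesis using s by (simp only: abs_mult abs_of_nonneg)
  qed
  finally show ?thesis unfolding T_def .
qed

text \<open>Neither attainment of the supremum of |U|^2 nor vanishing at infinity is established. A
  point with z near r and points on both sides of it with z near 0 suffice, because K has slope at
  most 1/2 on [0, r] (\<open>Klip\<close>).\<close>

lemma calibration_lower_bound:
  fixes u v p q K :: "real \<Rightarrow> real"
  assumes k: "k \<ge> 1" and M: "M > 0" and r: "r > 0" "2 * M * r ^ k = 1"
    and K: "\<And>z. (K has_real_derivative sqrt \<bar>1 - 2 * M * z ^ k\<bar> / 2) (at z)"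
    and u: "\<And>x. (u has_real_derivative p x) (at x)" and v: "\<And>x. (v has_real_derivative q x) (at x)"
    and cont: "continuous_on UNIV p" "continuous_on UNIV q"
    and L2: "u \<in> L2" "v \<in> L2" "p \<in> L2" "q \<in> L2"
    and B: "\<And>x. \<bar>u x\<bar> \<le> B" "\<And>x. \<bar>v x\<bar> \<le> B" and nz: "u x0 \<noteq> 0 \<or> v x0 \<noteq> 0"
  obtains s where "s > 0" "integrable lborel (\<lambda>x. ((u x)\<^sup>2 + (v x)\<^sup>2) ^ (k+1))"
    "2 * (K r - K 0) \<le> integral\<^sup>L lborel (\<lambda>x. s / 2 * ((p x)\<^sup>2 + (q x)\<^sup>2) + s / 2 * ((u x)\<^sup>2 + (v x)\<^sup>2)
        - M * s ^ (k+1) * ((u x)\<^sup>2 + (v x)\<^sup>2) ^ (k+1))"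
proof -
  define \<rho> where "\<rho> x = (u x)\<^sup>2 + (v x)\<^sup>2" for x
  define m where "m = (SUP x. \<rho> x)"
  have \<rho>0: "\<rho> x \<ge> 0" for x by (simp add: \<rho>_def)
  have "\<rho> x \<le> B\<^sup>2 + B\<^sup>2" for x
    unfolding \<rho>_def using B by (intro add_mono) (metis abs_ge_zero power2_abs power_mono)+
  then have bdd: "bdd_above (range \<rho>)" by (auto simp: bdd_above_def)
  then have le_m: "\<rho> x \<le> m" for x unfolding m_def by (intro cSUP_upper) auto
  have "\<rho> x0 > 0" using nz by (simp add: \<rho>_def sum_power2_gt_zero_iff)
  then have m: "m > 0" using le_m[of x0] by linarith
  \<comment> \<open>Scales the supremum of z to exactly r, the largest value for which 1 - 2 M z^k
    is nonnegative.\<close>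
  define s where "s = r / m"
  have s: "s > 0" using r m by (simp add: s_def)
  define z where "z x = s * \<rho> x" for x
  have z0: "z x \<ge> 0" for x using s \<rho>0 by (simp add: z_def)
  have zr: "z x \<le> r" for x
    using mult_left_mono[OF le_m[of x], of s] s m by (simp add: z_def s_def)
  have zk: "2 * M * y ^ k \<le> 1" if "0 \<le> y" "y \<le> r" for y
    using mult_left_mono[OF power_mono[OF that(2,1), of k], of "2 * M"] M r by simp
  define E where "E x = s / 2 * ((p x)\<^sup>2 + (q x)\<^sup>2) + s / 2 * \<rho> x - M * s ^ (k+1) * \<rho> x ^ (k+1)" for x
  have E_eq: "E x = s / 2 * ((p x)\<^sup>2 + (q x)\<^sup>2) + z x / 2 - M * z x ^ (k+1)" for x
    by (simp add: E_def z_def power_mult_distrib algebra_simps)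
  have cu: "continuous_on UNIV u" and cv: "continuous_on UNIV v"
    using u v by (meson DERIV_isCont continuous_at_imp_continuous_on)+
  have i\<rho>: "integrable lborel \<rho>" unfolding \<rho>_def[abs_def] using L2 by (auto simp: L2_def)
  have i\<rho>k: "integrable lborel (\<lambda>x. \<rho> x ^ (k+1))"
  proof (rule Bochner_Integration.integrable_bound)
    show "integrable lborel (\<lambda>x. m ^ k * \<rho> x)" using i\<rho> by simp
    show "(\<lambda>x. \<rho> x ^ (k+1)) \<in> borel_measurable lborel" using i\<rho> by (intro borel_measurable_power) auto
    have "\<rho> x ^ (k+1) \<le> m ^ k * \<rho> x" for x
      using mult_right_mono[OF power_mono[OF le_m \<rho>0, of x k] \<rho>0[of x]] by (simp add: mult.commute)
    then show "AE x in lborel. norm (\<rho> x ^ (k+1)) \<le> norm (m ^ k * \<rho> x)"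
      using \<rho>0 m by (simp add: abs_mult)
  qed
  have iE: "integrable lborel E"
    unfolding E_def[abs_def] using i\<rho> i\<rho>k L2 by (auto simp: L2_def)
  let ?g = "\<lambda>x. sqrt \<bar>1 - 2 * M * z x ^ k\<bar> / 2 * (s * (2 * (u x * p x + v x * q x)))"
  have g: "\<bar>?g x\<bar> \<le> E x" for x
    unfolding E_eq using s zk[OF z0 zr, of x] by (intro calibration_pointwise) (auto simp: z_def \<rho>_def)
  \<comment> \<open>Nonnegativity of the density allows the integral over the line to be cut down to
    a bounded interval.\<close>
  have E0: "E x \<ge> 0" for x using g[of x] by linarith
  have Dz: "(z has_real_derivative s * (2 * (u x * p x + v x * q x))) (at x)" for x
    unfolding z_def[abs_def] \<rho>_def[abs_def]
    by (auto intro!: derivative_eq_intros u v simp: algebra_simps)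
  have DK: "((\<lambda>x. K (z x)) has_real_derivative ?g x) (at x)" for x
    by (rule DERIV_chain2[OF K Dz])
  have "continuous_on UNIV z" using Dz by (meson DERIV_isCont continuous_at_imp_continuous_on)
  then have "continuous_on UNIV ?g" by (intro continuous_intros cu cv cont) auto
  then have lg: "loc_integrable ?g" by (rule loc_integrable_cont)
  have lE: "loc_integrable E" by (rule loc_integrable_integrable[OF iE])
  have Klip: "K y2 - K y1 \<le> (y2 - y1) / 2" if "0 \<le> y1" "y1 \<le> y2" "y2 \<le> r" for y1 y2
  proof (cases "y1 = y2")
    case False
    then have "y1 < y2" using that by simp
    from MVT2[OF this, of K "\<lambda>z. sqrt \<bar>1 - 2 * M * z ^ k\<bar> / 2"] K
    obtain y where y: "y1 < y" "y < y2" "K y2 - K y1 = (y2 - y1) * (sqrt \<bar>1 - 2 * M * y ^ k\<bar> / 2)" by blast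
    have "0 \<le> 2 * M * y ^ k" using that y M by simp
    then have "\<bar>1 - 2 * M * y ^ k\<bar> \<le> 1" using zk[of y] that y by auto
    then have "sqrt \<bar>1 - 2 * M * y ^ k\<bar> \<le> 1" by simp
    then have "(y2 - y1) * (sqrt \<bar>1 - 2 * M * y ^ k\<bar> / 2) \<le> (y2 - y1) * (1 / 2)"
      using that by (intro mult_left_mono) auto
    then show ?thesis using y by simp
  qed simp
  have iz: "integrable lborel z" unfolding z_def[abs_def] using i\<rho> by simp
  have main: "2 * (K (z y) - K 0) \<le> integral\<^sup>L lborel E" for y
  proof (rule field_le_epsilon)
    fix e :: real assume e: "e > 0"
    \<comment> \<open>This length makes the averaging bound for z on an interval of length h equal
      to e.\<close>
    define h where "h = (integral\<^sup>L lborel z + 1) / e"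
    have "integral\<^sup>L lborel z \<ge> 0" using z0 by (intro Bochner_Integration.integral_nonneg)
    then have h: "h > 0" "(integral\<^sup>L lborel z + 1) / h = e" using e by (auto simp: h_def)
    obtain x1 where x1: "x1 \<in> {y-h..y}" "z x1 \<le> e"
      using integrable_small_value[OF iz z0 h(1), of "y - h"] h by auto
    obtain x2 where x2: "x2 \<in> {y..y+h}" "z x2 \<le> e"
      using integrable_small_value[OF iz z0 h(1), of y] h by auto
    have "K (z y) - K (z x1) = integral {x1..y} ?g"
      using FTC_real[OF DK, of x1 y] x1 by simp
    also have "\<dots> \<le> integral {x1..y} E"
      by (intro integral_le loc_integrable_integrable_on lg lE abs_le_D1[OF g])
    finally have 1: "K (z y) - K (z x1) \<le> integral {x1..y} E" .
    have eq: "integral {y..x2} ?g = K (z x2) - K (z y)"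
      by (rule FTC_real[OF DK]) (use x2 in auto)
    have "K (z y) - K (z x2) = - integral {y..x2} ?g"
      unfolding eq by simp
    also have "\<dots> = integral {y..x2} (\<lambda>x. - ?g x)"
      by (rule Henstock_Kurzweil_Integration.integral_neg[symmetric])
    also have "\<dots> \<le> integral {y..x2} E"
      by (intro integral_le integrable_neg loc_integrable_integrable_on lg lE abs_le_D2[OF g])
    finally have 2: "K (z y) - K (z x2) \<le> integral {y..x2} E" .
    have "integral {x1..y} E + integral {y..x2} E = integral {x1..x2} E"
      using x1 x2 by (intro Henstock_Kurzweil_Integration.integral_combine loc_integrable_integrable_on lE) auto
    also have "\<dots> \<le> integral\<^sup>L lborel E" by (rule integral_Icc_le[OF iE E0])
    \<comment> \<open>By \<open>Klip\<close>, replacing K (z x1) and K (z x2) by K 0 costs at most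
      e/2 each.\<close>
    finally show "2 * (K (z y) - K 0) \<le> integral\<^sup>L lborel E + e"
      using 1 2 Klip[of 0 "z x1"] Klip[of 0 "z x2"] z0 zr x1 x2 by (simp add: field_simps)
  qed
  have "2 * (K r - K 0) \<le> integral\<^sup>L lborel E"
  proof (rule field_le_epsilon)
    fix e :: real assume e: "e > 0"
    \<comment> \<open>The gap e / s in the unscaled supremum becomes a gap e below r after
      multiplication by s.\<close>
    have "m - e / s < m" using e s by simp
    then obtain y where y: "m - e / s < \<rho> y" unfolding m_def using less_cSUP_iff[OF _ bdd] by auto
    have "r - e = s * (m - e / s)" using s m by (simp add: s_def field_simps)
    also have "\<dots> < z y" unfolding z_def using y s by (intro mult_strict_left_mono) auto
    finally have "r - z y < e" by simp
    then show "2 * (K r - K 0) \<le> integral\<^sup>L lborel E + e"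
      using main[of y] Klip[of "z y" r] z0[of y] zr[of y] by simp
  qed
  then show ?thesis using that[OF s] i\<rho>k unfolding E_def[abs_def] \<rho>_def by blast
qed

text \<open>On the soliton the root in K' equals |tanh(kx)|, so the derivative of K(s^2) is s'^2 for
  x < 0 and -s'^2 for x > 0. Each half line contributes at most K(R^2) - K(0) by monotonicity of K,
  so no limit of the profile is needed.\<close>

lemma soliton_calibration_upper_bound:
  fixes K :: "real \<Rightarrow> real"
  assumes k: "k \<ge> 1" and R: "R > 0" "2 * M * R ^ (2*k) = 1"
    and K: "\<And>z. (K has_real_derivative sqrt \<bar>1 - 2 * M * z ^ k\<bar> / 2) (at z)"
    and i: "integrable lborel (\<lambda>x. (- soliton k R x * tanh (real k * x))\<^sup>2)"
  shows "integral\<^sup>L lborel (\<lambda>x. (- soliton k R x * tanh (real k * x))\<^sup>2) \<le> 2 * (K (R\<^sup>2) - K 0)"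
proof -
  let ?s = "soliton k R" and ?P = "\<lambda>x. (- soliton k R x * tanh (real k * x))\<^sup>2"
  have Kmono: "K 0 \<le> K y" if "0 \<le> y" for y
    by (rule DERIV_nonneg_imp_nondecreasing[OF that]) (use K in \<open>auto intro!: exI\<close>)
  have D: "((\<lambda>x. K ((?s x)\<^sup>2)) has_real_derivative - \<bar>tanh (real k * x)\<bar> * (?s x * ?s x * tanh (real k * x))) (at x)" for x
  proof -
    have "((\<lambda>x. (?s x)\<^sup>2) has_real_derivative 2 * (?s x * (- ?s x * tanh (real k * x)))) (at x)"
      by (auto intro!: derivative_eq_intros soliton_DERIV k)
    from DERIV_chain2[OF K this]
    have "((\<lambda>x. K ((?s x)\<^sup>2)) has_real_derivative
       sqrt \<bar>1 - 2 * M * ((?s x)\<^sup>2) ^ k\<bar> / 2 * (2 * (?s x * (- ?s x * tanh (real k * x))))) (at x)" .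
    moreover have "1 - 2 * M * ((?s x)\<^sup>2) ^ k = (tanh (real k * x))\<^sup>2"
      using soliton_power[OF k R(2), of x] by (simp add: power_mult)
    then have e: "sqrt \<bar>1 - 2 * M * ((?s x)\<^sup>2) ^ k\<bar> = \<bar>tanh (real k * x)\<bar>" by simp
    ultimately show ?thesis unfolding e by (simp add: algebra_simps)
  qed
  have pos: "integral {0..real n} ?P \<le> K (R\<^sup>2) - K 0" for n
  proof -
    have "((\<lambda>x. - K ((?s x)\<^sup>2)) has_real_derivative \<bar>tanh (real k * x)\<bar> * (?s x * ?s x * tanh (real k * x))) (at x)" for x
      using DERIV_minus[OF D] by simp
    from FTC_real[OF this, of 0 "real n"]
    have "integral {0..real n} (\<lambda>x. \<bar>tanh (real k * x)\<bar> * (?s x * ?s x * tanh (real k * x))) = K (R\<^sup>2) - K ((?s (real n))\<^sup>2)"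
      by (simp add: soliton_0)
    moreover have "integral {0..real n} ?P = integral {0..real n} (\<lambda>x. \<bar>tanh (real k * x)\<bar> * (?s x * ?s x * tanh (real k * x)))"
      by (rule integral_cong) (simp add: power2_eq_square)
    ultimately show ?thesis using Kmono[of "(?s (real n))\<^sup>2"] by simp
  qed
  have neg: "integral {- real n..0} ?P \<le> K (R\<^sup>2) - K 0" for n
  proof -
    from FTC_real[OF D, of "- real n" 0]
    have "integral {- real n..0} (\<lambda>x. - \<bar>tanh (real k * x)\<bar> * (?s x * ?s x * tanh (real k * x))) = K (R\<^sup>2) - K ((?s (- real n))\<^sup>2)"
      by (simp add: soliton_0)
    moreover have "integral {- real n..0} ?P = integral {- real n..0} (\<lambda>x. - \<bar>tanh (real k * x)\<bar> * (?s x * ?s x * tanh (real k * x)))"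
      by (rule integral_cong) (simp add: power2_eq_square mult_nonneg_nonpos)
    ultimately show ?thesis using Kmono[of "(?s (- real n))\<^sup>2"] by simp
  qed
  have "integral {- real n..real n} ?P \<le> 2 * (K (R\<^sup>2) - K 0)" for n
    using pos[of n] neg[of n] Henstock_Kurzweil_Integration.integral_combine[of "- real n" 0 "real n" ?P]
      loc_integrable_integrable_on[OF loc_integrable_integrable[OF i]] by auto
  then show ?thesis
    using LIMSEQ_le_const2[OF integral_symmetric_Icc_tendsto[OF i]] by blast
qed

section \<open>Weak solutions\<close>

lemma primitive_cont_DERIV:
  assumes F: "primitive F f" and f: "continuous_on UNIV f"
  shows "(F has_real_derivative f x) (at x)"
proof -
  obtain G where G: "\<And>x. (G has_real_derivative f x) (at x)"
    using continuous_antiderivative[OF f] by blast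
  have "F y = G y + (F 0 - G 0)" for y
    using F FTC_real[OF G, of 0 y] FTC_real[OF G, of y 0] unfolding primitive_def
    by (cases "0 \<le> y") (smt (verit))+
  then have "F = (\<lambda>y. G y + (F 0 - G 0))" by blast
  moreover have "((\<lambda>y. G y + (F 0 - G 0)) has_real_derivative f x) (at x)"
    by (auto intro!: derivative_eq_intros G)
  ultimately show ?thesis by simp
qed

lemma L2_cong_AE:
  assumes "u \<in> L2" "v \<in> borel_measurable lborel" "AE x in lborel. u x = v x"
  shows "v \<in> L2"
  using assms unfolding L2_def
  by (auto intro!: Bochner_Integration.integrable_cong_AE_imp[of lborel "\<lambda>x. (u x)\<^sup>2" "\<lambda>x. (v x)\<^sup>2"] elim!: AE_mp)

lemma continuous_on_ff:
  "continuous_on S u \<Longrightarrow> continuous_on S v \<Longrightarrow> continuous_on S (\<lambda>x. ff k a b c d (u x) (v x))"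
  unfolding ff_def by (intro continuous_intros)

lemma weak_solution_swap:
  "weak_solution k a b c d \<phi> \<psi> \<Longrightarrow> weak_solution k a b d c \<psi> \<phi>"
  unfolding weak_solution_def gg_eq_ff by auto

text \<open>Testing with smooth functions says that F - f(F, G) is the weak derivative of
  \<open>wderiv \<phi>\<close>. It is continuous for continuous representatives, so
  \<open>wderiv \<phi>\<close> has a continuous representative P, and F is continuously
  differentiable. Of the other component only continuity is required, so the two components can be
  treated in turn.\<close>

lemma weak_solution_regular:
  assumes sol: "weak_solution k a b c d \<phi> \<psi>"
    and F: "primitive F (wderiv \<phi>)" "AE x in lborel. \<phi> x = F x"
    and G: "continuous_on UNIV G" "AE x in lborel. \<psi> x = G x"
  obtains P where "\<And>x. (F has_real_derivative P x) (at x)" "continuous_on UNIV P" "P \<in> L2"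
    "AE x in lborel. wderiv \<phi> x = P x"
proof -
  have \<phi>: "\<phi> \<in> H1" and eq: "\<And>w. w \<in> H1 \<Longrightarrow> integral\<^sup>L lborel (\<lambda>x. \<phi> x * w x + wderiv \<phi> x * wderiv w x
      - ff k a b c d (\<phi> x) (\<psi> x) * w x) = 0"
    using sol by (auto simp: weak_solution_def)
  have w2: "wderiv \<phi> \<in> L2" by (rule wderiv_H1[OF \<phi>])
  have lw: "loc_integrable (wderiv \<phi>)" by (rule L2_loc_integrable[OF w2])
  have cF: "continuous_on UNIV F" by (rule primitive_cont[OF lw F(1)])
  define W where "W x = F x - ff k a b c d (F x) (G x)" for x
  have cW: "continuous_on UNIV W"
    unfolding W_def[abs_def] by (intro continuous_intros continuous_on_ff cF G)
  have lW: "loc_integrable W" by (rule loc_integrable_cont[OF cW])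
  have "has_weak_deriv (wderiv \<phi>) W"
    unfolding has_weak_deriv_def
  proof (intro allI impI)
    fix \<eta> assume t: "test_fun \<eta>"
    have [measurable]: "\<phi> \<in> borel_measurable borel" "wderiv \<phi> \<in> borel_measurable borel"
      "\<psi> \<in> borel_measurable borel" "wderiv \<eta> \<in> borel_measurable borel" "\<eta> \<in> borel_measurable borel"
      using H1_L2[OF \<phi>] w2 sol H1_L2 wderiv_H1(1)[OF test_fun_H1(1)[OF t]] H1_L2[OF test_fun_H1(1)[OF t]]
      by (auto simp: L2_def weak_solution_def)
    have [measurable]: "(\<lambda>x. ff k a b c d (\<phi> x) (\<psi> x)) \<in> borel_measurable borel"
      unfolding ff_def by measurable
    have i: "integrable lborel (\<lambda>x. wderiv \<phi> x * deriv \<eta> x)" "integrable lborel (\<lambda>x. W x * \<eta> x)"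
      by (intro integrable_mult_test lw lW t)+
    have "0 = integral\<^sup>L lborel (\<lambda>x. \<phi> x * \<eta> x + wderiv \<phi> x * wderiv \<eta> x - ff k a b c d (\<phi> x) (\<psi> x) * \<eta> x)"
      using eq[OF test_fun_H1(1)[OF t]] by simp
    also have "\<dots> = integral\<^sup>L lborel (\<lambda>x. wderiv \<phi> x * deriv \<eta> x + W x * \<eta> x)"
    proof (rule integral_cong_AE)
      show "(\<lambda>x. wderiv \<phi> x * deriv \<eta> x + W x * \<eta> x) \<in> borel_measurable lborel" using i by auto
      show "AE x in lborel. \<phi> x * \<eta> x + wderiv \<phi> x * wderiv \<eta> x - ff k a b c d (\<phi> x) (\<psi> x) * \<eta> x
         = wderiv \<phi> x * deriv \<eta> x + W x * \<eta> x"
        using F(2) G(2) test_fun_H1(2)[OF t] by eventually_elim (simp add: W_def algebra_simps)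
    qed measurable
    also have "\<dots> = integral\<^sup>L lborel (\<lambda>x. wderiv \<phi> x * deriv \<eta> x) + integral\<^sup>L lborel (\<lambda>x. W x * \<eta> x)"
      by (intro Bochner_Integration.integral_add i)
    finally show "integral\<^sup>L lborel (\<lambda>x. wderiv \<phi> x * deriv \<eta> x) = - integral\<^sup>L lborel (\<lambda>x. W x * \<eta> x)"
      by simp
  qed
  then obtain P where P: "primitive P W" "AE x in lborel. wderiv \<phi> x = P x"
    using weak_deriv_primitive[OF lw lW] by blast
  have cP: "continuous_on UNIV P" by (rule primitive_cont[OF lW P(1)])
  have "primitive F P" by (rule primitive_cong_AE[OF F(1) lw loc_integrable_cont[OF cP] P(2)])
  then have "\<And>x. (F has_real_derivative P x) (at x)" using primitive_cont_DERIV cP by blast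
  moreover have "P \<in> L2"
    by (rule L2_cong_AE[OF w2 _ P(2)]) (use cP in \<open>auto intro: borel_measurable_continuous_onI\<close>)
  ultimately show ?thesis using that cP P(2) by blast
qed

text \<open>Two powers of the size s of (u, v) are integrable and the remaining 2k are bounded by
  powers of B. Integrability is needed to split the Nehari integral, since a non-integrable function
  has integral 0 by convention.\<close>

lemma integrable_ff_mult:
  assumes k: "k \<ge> 1" and nn: "a \<ge> 0" "b \<ge> 0" "c \<ge> 0" "d \<ge> 0"
    and L2: "u \<in> L2" "v \<in> L2" and B: "\<And>x. \<bar>u x\<bar> \<le> B" "\<And>x. \<bar>v x\<bar> \<le> B"
  shows "integrable lborel (\<lambda>x. ff k a b c d (u x) (v x) * u x)"
proof (rule Bochner_Integration.integrable_bound)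
  let ?C = "a + b + (real k + 2) / real k * c + d"
  have C: "?C \<ge> 0" using nn by simp
  have [measurable]: "u \<in> borel_measurable borel" "v \<in> borel_measurable borel" using L2 by (auto simp: L2_def)
  show "(\<lambda>x. ff k a b c d (u x) (v x) * u x) \<in> borel_measurable lborel"
    unfolding ff_def by measurable
  show "integrable lborel (\<lambda>x. ?C * ((B\<^sup>2) ^ k * ((u x)\<^sup>2 + (v x)\<^sup>2)))"
    using L2 by (auto simp: L2_def)
  have "\<bar>ff k a b c d (u x) (v x)\<bar> * \<bar>u x\<bar> \<le> ?C * ((B\<^sup>2) ^ k * ((u x)\<^sup>2 + (v x)\<^sup>2))" for x
  proof -
    define s where "s = max \<bar>u x\<bar> \<bar>v x\<bar>"
    have s: "\<bar>u x\<bar> \<le> s" "\<bar>v x\<bar> \<le> s" "s \<le> B" "0 \<le> s" using B[of x] by (auto simp: s_def)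
    have s2: "s\<^sup>2 \<le> (u x)\<^sup>2 + (v x)\<^sup>2" by (auto simp: s_def max_def)
    have "\<bar>ff k a b c d (u x) (v x)\<bar> * \<bar>u x\<bar> \<le> (?C * s ^ (2*k+1)) * s"
      using s C by (intro mult_mono ff_bound k nn) auto
    also have "\<dots> = ?C * ((s\<^sup>2) ^ k * s\<^sup>2)" by (simp add: power_mult power2_eq_square)
    also have "\<dots> \<le> ?C * ((B\<^sup>2) ^ k * ((u x)\<^sup>2 + (v x)\<^sup>2))"
      using s s2 C by (intro mult_left_mono mult_mono power_mono) auto
    finally show ?thesis .
  qed
  then show "AE x in lborel. norm (ff k a b c d (u x) (v x) * u x) \<le> norm (?C * ((B\<^sup>2) ^ k * ((u x)\<^sup>2 + (v x)\<^sup>2)))"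
    using C by (simp add: abs_mult)
qed

text \<open>The weak equation tested with \<phi> itself, then rewritten for the regular
  representatives.\<close>

lemma Nehari_identity:
  assumes sol: "weak_solution k a b c d \<phi> \<psi>"
    and F: "AE x in lborel. \<phi> x = F x" "F \<in> L2" and G: "AE x in lborel. \<psi> x = G x"
    and P: "AE x in lborel. wderiv \<phi> x = P x" "P \<in> L2"
    and i: "integrable lborel (\<lambda>x. ff k a b c d (F x) (G x) * F x)"
  shows "integral\<^sup>L lborel (\<lambda>x. (F x)\<^sup>2) + integral\<^sup>L lborel (\<lambda>x. (P x)\<^sup>2)
    = integral\<^sup>L lborel (\<lambda>x. ff k a b c d (F x) (G x) * F x)"
proof -
  have iF: "integrable lborel (\<lambda>x. (F x)\<^sup>2)" "integrable lborel (\<lambda>x. (P x)\<^sup>2)" using F P by (auto simp: L2_def)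
  have \<phi>: "\<phi> \<in> H1" "\<psi> \<in> H1" using sol by (auto simp: weak_solution_def)
  have [measurable]: "\<phi> \<in> borel_measurable borel" "wderiv \<phi> \<in> borel_measurable borel" "\<psi> \<in> borel_measurable borel"
    using \<phi> H1_L2 wderiv_H1(1) by (auto simp: L2_def)
  have "0 = integral\<^sup>L lborel (\<lambda>x. \<phi> x * \<phi> x + wderiv \<phi> x * wderiv \<phi> x - ff k a b c d (\<phi> x) (\<psi> x) * \<phi> x)"
    using sol \<phi> by (simp add: weak_solution_def)
  also have "\<dots> = integral\<^sup>L lborel (\<lambda>x. (F x)\<^sup>2 + (P x)\<^sup>2 - ff k a b c d (F x) (G x) * F x)"
  proof (rule integral_cong_AE)
    show "(\<lambda>x. \<phi> x * \<phi> x + wderiv \<phi> x * wderiv \<phi> x - ff k a b c d (\<phi> x) (\<psi> x) * \<phi> x) \<in> borel_measurable lborel"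
      unfolding ff_def by measurable
    show "(\<lambda>x. (F x)\<^sup>2 + (P x)\<^sup>2 - ff k a b c d (F x) (G x) * F x) \<in> borel_measurable lborel"
      using iF i by auto
    show "AE x in lborel. \<phi> x * \<phi> x + wderiv \<phi> x * wderiv \<phi> x - ff k a b c d (\<phi> x) (\<psi> x) * \<phi> x
      = (F x)\<^sup>2 + (P x)\<^sup>2 - ff k a b c d (F x) (G x) * F x"
      using F(1) G P(1) by eventually_elim (simp add: power2_eq_square)
  qed
  also have "\<dots> = integral\<^sup>L lborel (\<lambda>x. (F x)\<^sup>2) + integral\<^sup>L lborel (\<lambda>x. (P x)\<^sup>2)
    - integral\<^sup>L lborel (\<lambda>x. ff k a b c d (F x) (G x) * F x)"
    using iF i by simp
  finally show ?thesis by simp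
qed

lemma action_cong_AE:
  assumes m: "u \<in> borel_measurable lborel" "v \<in> borel_measurable lborel" "F \<in> borel_measurable lborel" "G \<in> borel_measurable lborel"
    "wderiv u \<in> borel_measurable lborel" "wderiv v \<in> borel_measurable lborel" "P \<in> borel_measurable lborel" "Q \<in> borel_measurable lborel"
    and ae: "AE x in lborel. u x = F x" "AE x in lborel. v x = G x" "AE x in lborel. wderiv u x = P x" "AE x in lborel. wderiv v x = Q x"
  shows "action k a b c d u v = 1/2 * (integral\<^sup>L lborel (\<lambda>x. (F x)^2) + integral\<^sup>L lborel (\<lambda>x. (G x)^2))
   + 1/2 * (integral\<^sup>L lborel (\<lambda>x. (P x)^2) + integral\<^sup>L lborel (\<lambda>x. (Q x)^2))
   - integral\<^sup>L lborel (\<lambda>x. HH k a b c d (F x) (G x))"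
proof -
  note [measurable] = m
  have sq: "integral\<^sup>L lborel (\<lambda>x. (f x)^2) = integral\<^sup>L lborel (\<lambda>x. (g x)^2)"
    if "AE x in lborel. f x = g x" "f \<in> borel_measurable lborel" "g \<in> borel_measurable lborel" for f g :: "real \<Rightarrow> real"
    by (rule integral_cong_AE) (use that in auto)
  have "integral\<^sup>L lborel (\<lambda>x. HH k a b c d (u x) (v x)) = integral\<^sup>L lborel (\<lambda>x. HH k a b c d (F x) (G x))"
  proof (rule integral_cong_AE)
    show "(\<lambda>x. HH k a b c d (u x) (v x)) \<in> borel_measurable lborel" unfolding HH_def by measurable
    show "(\<lambda>x. HH k a b c d (F x) (G x)) \<in> borel_measurable lborel" unfolding HH_def by measurable
    show "AE x in lborel. HH k a b c d (u x) (v x) = HH k a b c d (F x) (G x)"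
      using ae(1,2) by eventually_elim simp
  qed
  then show ?thesis
    unfolding action_def using sq[OF ae(1)] sq[OF ae(2)] sq[OF ae(3)] sq[OF ae(4)] m by simp
qed

text \<open>Let \<open>A\<close> be the squared H1 norm of the pair. The two Nehari identities and
  Euler's relation give \<open>A\<close> / (2k+2) as the integral of H, so the action of tU, with s
  = t^2, is s A / 2 - s^(k+1) A / (2k+2). At s = 1 this is the action of the solution; the
  calibration bounds it from below for its own s.\<close>

lemma weak_solution_action_lower_bound:
  fixes K :: "real \<Rightarrow> real"
  assumes k: "k \<ge> 1" and nn: "a \<ge> 0" "b \<ge> 0" "c \<ge> 0" "d \<ge> 0"
    and M: "M > 0" "\<And>u v. HH k a b c d u v \<le> M * (u\<^sup>2 + v\<^sup>2) ^ (k+1)"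
    and r: "r > 0" "2 * M * r ^ k = 1"
    and K: "\<And>z. (K has_real_derivative sqrt \<bar>1 - 2 * M * z ^ k\<bar> / 2) (at z)"
    and sol: "weak_solution k a b c d \<phi> \<psi>" and nz: "\<not> is_zero_pair \<phi> \<psi>"
  shows "2 * (K r - K 0) \<le> action k a b c d \<phi> \<psi>"
proof -
  have H1: "\<phi> \<in> H1" "\<psi> \<in> H1" using sol by (auto simp: weak_solution_def)
  obtain F where F: "primitive F (wderiv \<phi>)" "AE x in lborel. \<phi> x = F x" using H1_primitive[OF H1(1)] .
  obtain G where G: "primitive G (wderiv \<psi>)" "AE x in lborel. \<psi> x = G x" using H1_primitive[OF H1(2)] .
  have cF: "continuous_on UNIV F" by (rule primitive_cont[OF L2_loc_integrable[OF wderiv_H1(1)[OF H1(1)]] F(1)])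
  have cG: "continuous_on UNIV G" by (rule primitive_cont[OF L2_loc_integrable[OF wderiv_H1(1)[OF H1(2)]] G(1)])
  obtain P where P: "\<And>x. (F has_real_derivative P x) (at x)" "continuous_on UNIV P" "P \<in> L2"
    "AE x in lborel. wderiv \<phi> x = P x"
    using weak_solution_regular[OF sol F cG G(2)] by blast
  obtain Q where Q: "\<And>x. (G has_real_derivative Q x) (at x)" "continuous_on UNIV Q" "Q \<in> L2"
    "AE x in lborel. wderiv \<psi> x = Q x"
    using weak_solution_regular[OF weak_solution_swap[OF sol] G cF F(2)] by blast
  have F2: "F \<in> L2" by (rule L2_cong_AE[OF H1_L2[OF H1(1)] _ F(2)]) (use cF in \<open>auto intro: borel_measurable_continuous_onI\<close>)
  have G2: "G \<in> L2" by (rule L2_cong_AE[OF H1_L2[OF H1(2)] _ G(2)]) (use cG in \<open>auto intro: borel_measurable_continuous_onI\<close>)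
  obtain B1 where B1: "\<And>x. \<bar>F x\<bar> \<le> B1" using primitive_L2_bounded[OF wderiv_H1(1)[OF H1(1)] F2 F(1)] by blast
  obtain B2 where B2: "\<And>x. \<bar>G x\<bar> \<le> B2" using primitive_L2_bounded[OF wderiv_H1(1)[OF H1(2)] G2 G(1)] by blast
  define B where "B = max B1 B2"
  have B: "\<And>x. \<bar>F x\<bar> \<le> B" "\<And>x. \<bar>G x\<bar> \<le> B" using B1 B2 by (auto simp: B_def intro: le_max_iff_disj[THEN iffD2])
  have "\<exists>x0. F x0 \<noteq> 0 \<or> G x0 \<noteq> 0"
  proof (rule ccontr)
    assume z: "\<not> ?thesis"
    from F(2) G(2) have "AE x in lborel. \<phi> x = 0 \<and> \<psi> x = 0" by eventually_elim (use z in auto)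
    then show False using nz by (simp add: is_zero_pair_def)
  qed
  then obtain x0 where x0: "F x0 \<noteq> 0 \<or> G x0 \<noteq> 0" by blast
  let ?H = "\<lambda>x. HH k a b c d (F x) (G x)"
  define A where "A = integral\<^sup>L lborel (\<lambda>x. (F x)\<^sup>2) + integral\<^sup>L lborel (\<lambda>x. (P x)\<^sup>2)
    + (integral\<^sup>L lborel (\<lambda>x. (G x)\<^sup>2) + integral\<^sup>L lborel (\<lambda>x. (Q x)\<^sup>2))"
  have A0: "A \<ge> 0" unfolding A_def by (intro add_nonneg_nonneg Bochner_Integration.integral_nonneg) auto
  have if1: "integrable lborel (\<lambda>x. ff k a b c d (F x) (G x) * F x)"
    by (rule integrable_ff_mult[OF k nn F2 G2 B])
  have if2: "integrable lborel (\<lambda>x. ff k a b d c (G x) (F x) * G x)"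
    by (rule integrable_ff_mult[OF k nn(1,2,4,3) G2 F2 B(2,1)])
  have Euler: "?H x = (ff k a b c d (F x) (G x) * F x + ff k a b d c (G x) (F x) * G x) / (2 * real k + 2)" for x
    using HH_Euler[OF k, of "F x" a b c d "G x"] by (simp add: gg_eq_ff field_simps)
  have iH: "integrable lborel ?H" unfolding Euler using if1 if2 by simp
  have AH: "integral\<^sup>L lborel ?H = A / (2 * real k + 2)"
    unfolding Euler A_def using if1 if2 Nehari_identity[OF sol F(2) F2 G(2) P(4,3) if1]
      Nehari_identity[OF weak_solution_swap[OF sol] G(2) G2 F(2) Q(4,3) if2] by simp
  have "action k a b c d \<phi> \<psi> = 1/2 * (integral\<^sup>L lborel (\<lambda>x. (F x)^2) + integral\<^sup>L lborel (\<lambda>x. (G x)^2))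
   + 1/2 * (integral\<^sup>L lborel (\<lambda>x. (P x)^2) + integral\<^sup>L lborel (\<lambda>x. (Q x)^2)) - integral\<^sup>L lborel ?H"
    using H1 H1_L2 wderiv_H1(1) F2 G2 P Q F G by (intro action_cong_AE) (auto simp: L2_def)
  then have act: "action k a b c d \<phi> \<psi> = A / 2 - A / (2 * real k + 2)"
    unfolding AH by (simp add: A_def field_simps)
  obtain s where s: "s > 0" and i\<rho>: "integrable lborel (\<lambda>x. ((F x)\<^sup>2 + (G x)\<^sup>2) ^ (k+1))" and
    low: "2 * (K r - K 0) \<le> integral\<^sup>L lborel (\<lambda>x. s / 2 * ((P x)\<^sup>2 + (Q x)\<^sup>2) + s / 2 * ((F x)\<^sup>2 + (G x)\<^sup>2)
        - M * s ^ (k+1) * ((F x)\<^sup>2 + (G x)\<^sup>2) ^ (k+1))"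
    using calibration_lower_bound[OF k M(1) r K P(1) Q(1) P(2) Q(2) F2 G2 P(3) Q(3) B x0] by blast
  have isq: "integrable lborel (\<lambda>x. (F x)\<^sup>2)" "integrable lborel (\<lambda>x. (G x)\<^sup>2)"
    "integrable lborel (\<lambda>x. (P x)\<^sup>2)" "integrable lborel (\<lambda>x. (Q x)\<^sup>2)"
    using F2 G2 P(3) Q(3) by (auto simp: L2_def)
  note low
  also have "integral\<^sup>L lborel (\<lambda>x. s / 2 * ((P x)\<^sup>2 + (Q x)\<^sup>2) + s / 2 * ((F x)\<^sup>2 + (G x)\<^sup>2)
        - M * s ^ (k+1) * ((F x)\<^sup>2 + (G x)\<^sup>2) ^ (k+1))
     \<le> integral\<^sup>L lborel (\<lambda>x. s / 2 * ((P x)\<^sup>2 + (Q x)\<^sup>2) + s / 2 * ((F x)\<^sup>2 + (G x)\<^sup>2) - s ^ (k+1) * ?H x)"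
  proof (rule integral_mono)
    fix x
    have "s ^ (k+1) * ?H x \<le> s ^ (k+1) * (M * ((F x)\<^sup>2 + (G x)\<^sup>2) ^ (k+1))"
      using s by (intro mult_left_mono M) auto
    then show "s / 2 * ((P x)\<^sup>2 + (Q x)\<^sup>2) + s / 2 * ((F x)\<^sup>2 + (G x)\<^sup>2)
        - M * s ^ (k+1) * ((F x)\<^sup>2 + (G x)\<^sup>2) ^ (k+1) \<le> s / 2 * ((P x)\<^sup>2 + (Q x)\<^sup>2) + s / 2 * ((F x)\<^sup>2 + (G x)\<^sup>2) - s ^ (k+1) * ?H x"
      by (simp only: mult_ac)
  qed (use isq i\<rho> iH in auto)
  also have "\<dots> = s / 2 * A - s ^ (k+1) * integral\<^sup>L lborel ?H"
    unfolding A_def using isq iH by (simp add: algebra_simps)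
  also have "\<dots> = s / 2 * A - s ^ (k+1) * (A / (2 * real k + 2))" unfolding AH ..
  also have "\<dots> \<le> A / 2 - A / (2 * real k + 2)"
  proof -
    \<comment> \<open>The tangent at s = 1 lies below the convex power s^(k+1); thus the action
      along the ray is largest at s = 1.\<close>
    have "1 + real (k+1) * (s - 1) \<le> (1 + (s - 1)) ^ (k+1)"
      by (rule Bernoulli_inequality) (use s in simp)
    then have Bern: "(real k + 1) * s - s ^ (k+1) \<le> real k" by (simp add: algebra_simps)
    define D where "D = A / (2 * real k + 2)"
    have D: "D \<ge> 0" "A = 2 * ((real k + 1) * D)" using A0 by (simp_all add: D_def field_simps)
    have "D * ((real k + 1) * s - s ^ (k+1)) \<le> D * real k"
      using Bern D by (intro mult_left_mono) auto
    then have "s / 2 * A - s ^ (k+1) * D \<le> A / 2 - D" unfolding D(2) by (simp add: algebra_simps)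
    then show ?thesis unfolding D_def .
  qed
  finally show ?thesis unfolding act .
qed

section \<open>The ground state\<close>

lemma soliton_L2:
  assumes k: "k \<ge> 1" and m: "f \<in> borel_measurable lborel" and b: "\<And>x. \<bar>f x\<bar> \<le> C * \<bar>soliton k R x\<bar>"
  shows "f \<in> L2"
proof -
  have [measurable]: "f \<in> borel_measurable borel" using m by simp
  have "integrable lborel (\<lambda>x. (f x)\<^sup>2)"
  proof (rule Bochner_Integration.integrable_bound)
    show "integrable lborel (\<lambda>x. C\<^sup>2 * (4 * R\<^sup>2 * inverse (1 + x\<^sup>2)))"
      using integrable_inverse_1_plus_square by simp
    have "(f x)\<^sup>2 \<le> C\<^sup>2 * (4 * R\<^sup>2 * inverse (1 + x\<^sup>2))" for x
    proof -
      have "(f x)\<^sup>2 \<le> (C * \<bar>soliton k R x\<bar>)\<^sup>2" using power_mono[OF b[of x], of 2] by simp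
      also have "\<dots> = C\<^sup>2 * (soliton k R x)\<^sup>2" by (simp add: power_mult_distrib)
      also have "\<dots> \<le> C\<^sup>2 * (4 * R\<^sup>2 * inverse (1 + x\<^sup>2))"
        by (intro mult_left_mono soliton_sq_bound k) auto
      finally show ?thesis .
    qed
    then show "AE x in lborel. norm ((f x)\<^sup>2) \<le> norm (C\<^sup>2 * (4 * R\<^sup>2 * inverse (1 + x\<^sup>2)))" by simp
  qed measurable
  then show ?thesis by (simp add: L2_def)
qed

lemma tendsto_zero_of_sq_le:
  assumes "\<And>x. (g x)\<^sup>2 \<le> c * inverse (1 + x\<^sup>2)"
  shows "(g \<longlongrightarrow> (0::real)) at_top" "(g \<longlongrightarrow> 0) at_bot"
proof -
  have le: "norm (g x) \<le> sqrt (c * inverse (1 + x\<^sup>2))" for x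
    using real_sqrt_le_mono[OF assms[of x]] by simp
  have *: "(g \<longlongrightarrow> 0) F" if "filterlim (\<lambda>x::real. x\<^sup>2) at_top F" for F
  proof (rule Lim_null_comparison)
    have "((\<lambda>x. sqrt (c * inverse (1 + x\<^sup>2))) \<longlongrightarrow> sqrt (c * 0)) F"
      by (intro tendsto_intros tendsto_inverse_0_at_top
          filterlim_tendsto_add_at_top[OF tendsto_const] that)
    then show "((\<lambda>x. sqrt (c * inverse (1 + x\<^sup>2))) \<longlongrightarrow> 0) F" by simp
  qed (use le in simp)
  show "(g \<longlongrightarrow> 0) at_top" by (rule *) (auto intro: filterlim_pow_at_top filterlim_ident)
  show "(g \<longlongrightarrow> 0) at_bot" by (rule *) (auto intro: filterlim_pow_at_bot_even filterlim_ident)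
qed

text \<open>The factor \<gamma> will be \<alpha> and \<beta>. The nonlinear term is written in the
  form that f and g take on (\<alpha> s, \<beta> s) by homogeneity and the gradient condition, so
  both components satisfy the same equation, linear in \<gamma>.\<close>

lemma soliton_weak_equation:
  assumes k: "k \<ge> 1" and R: "R > 0" "2 * M * R ^ (2*k) = 1"
  defines "p \<equiv> \<lambda>x. - soliton k R x * tanh (real k * x)"
  shows "soliton k R \<in> L2" "p \<in> L2" "(\<lambda>x. \<gamma> * soliton k R x) \<in> H1"
    "AE x in lborel. wderiv (\<lambda>x. \<gamma> * soliton k R x) x = \<gamma> * p x"
    "w \<in> H1 \<Longrightarrow> integral\<^sup>L lborel (\<lambda>x. (\<gamma> * soliton k R x) * w x + wderiv (\<lambda>x. \<gamma> * soliton k R x) x * wderiv w x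
      - soliton k R x ^ (2*k+1) * ((2 * real k + 2) * M * \<gamma>) * w x) = 0"
proof -
  let ?s = "soliton k R"
  define g where "g x = ?s x - (2 * real k + 2) * M * ?s x ^ (2*k+1)" for x
  have Ds: "(?s has_real_derivative p x) (at x)" for x
    unfolding p_def by (rule soliton_DERIV[OF k])
  have Dp: "(p has_real_derivative g x) (at x)" for x
    unfolding p_def g_def by (rule soliton_deriv_DERIV[OF k R(2)])
  have cs: "continuous_on UNIV ?s" and cp: "continuous_on UNIV p"
    using Ds Dp by (meson DERIV_isCont continuous_at_imp_continuous_on)+
  have cg: "continuous_on UNIV g" unfolding g_def[abs_def] by (intro continuous_intros cs)
  have [measurable]: "?s \<in> borel_measurable borel" "p \<in> borel_measurable borel" "g \<in> borel_measurable borel"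
    using cs cp cg by (auto intro: borel_measurable_continuous_onI)
  have spos: "?s x > 0" for x by (rule soliton_pos[OF R(1)])
  have th: "\<bar>tanh (real k * x)\<bar> \<le> 1" for x using tanh_real_bounds[of "real k * x"] by auto
  have ple: "\<bar>p x\<bar> \<le> 1 * \<bar>?s x\<bar>" for x
    using mult_left_mono[OF th[of x], of "\<bar>?s x\<bar>"] by (simp add: p_def abs_mult)
  have gle: "\<bar>g x\<bar> \<le> (real k + 2) * \<bar>?s x\<bar>" for x
  proof -
    have "(tanh (real k * x))\<^sup>2 \<le> 1" using th[of x] by (simp add: abs_square_le_1)
    then have t: "0 \<le> 1 - (tanh (real k * x))\<^sup>2" "1 - (tanh (real k * x))\<^sup>2 \<le> 1" by auto
    \<comment> \<open>Replacing 2 M s^(2k) by 1 - tanh^2, which lies in [0, 1], bounds the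
      superlinear term of s'' by a multiple of s.\<close>
    have "g x = ?s x - (real k + 1) * ((1 - (tanh (real k * x))\<^sup>2) * ?s x)"
      unfolding g_def soliton_power[OF k R(2), symmetric] by (simp add: algebra_simps)
    moreover have "0 \<le> (1 - (tanh (real k * x))\<^sup>2) * ?s x" "(1 - (tanh (real k * x))\<^sup>2) * ?s x \<le> ?s x"
      using t spos[of x] by (auto intro!: mult_nonneg_nonneg mult_left_le_one_le)
    then have "0 \<le> (real k + 1) * ((1 - (tanh (real k * x))\<^sup>2) * ?s x)"
      "(real k + 1) * ((1 - (tanh (real k * x))\<^sup>2) * ?s x) \<le> (real k + 1) * ?s x"
      by (auto intro!: mult_nonneg_nonneg mult_left_mono)
    moreover have "(real k + 2) * ?s x = (real k + 1) * ?s x + ?s x" by (simp add: algebra_simps)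
    ultimately show ?thesis using spos[of x] by (simp only: abs_of_pos abs_le_iff) linarith
  qed
  show s2: "?s \<in> L2" by (rule soliton_L2[OF k, of _ 1]) auto
  show p2: "p \<in> L2" by (rule soliton_L2[OF k _ ple]) simp
  have g2: "g \<in> L2" by (rule soliton_L2[OF k _ gle]) simp
  have L2: "(\<lambda>x. \<gamma> * f x) \<in> L2" if "f \<in> L2" for f using that by (auto simp: L2_def power_mult_distrib)
  have wd: "has_weak_deriv (\<lambda>x. \<gamma> * ?s x) (\<lambda>x. \<gamma> * p x)"
    by (intro primitive_weak_deriv loc_integrable_cont continuous_intros cp primitive_DERIV DERIV_cmult Ds)
  show u: "(\<lambda>x. \<gamma> * ?s x) \<in> H1" by (rule H1_I[OF L2[OF s2] L2[OF p2] wd])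
  show ae: "AE x in lborel. wderiv (\<lambda>x. \<gamma> * ?s x) x = \<gamma> * p x"
    by (rule wderiv_AE[OF L2[OF s2] L2[OF p2] wd])
  assume w: "w \<in> H1"
  obtain W where W: "primitive W (wderiv w)" "AE x in lborel. w x = W x" using H1_primitive[OF w] .
  have w2: "wderiv w \<in> L2" by (rule wderiv_H1[OF w])
  have lw: "loc_integrable (wderiv w)" by (rule L2_loc_integrable[OF w2])
  have cW: "continuous_on UNIV W" by (rule primitive_cont[OF lw W(1)])
  have W2: "W \<in> L2" by (rule L2_cong_AE[OF H1_L2[OF w] _ W(2)]) (use cW in \<open>auto intro: borel_measurable_continuous_onI\<close>)
  obtain B where B: "\<And>x. \<bar>W x\<bar> \<le> B" using primitive_L2_bounded[OF w2 W2 W(1)] by blast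
  have "(p x)\<^sup>2 \<le> 4 * R\<^sup>2 * inverse (1 + x\<^sup>2)" for x
    using power_mono[OF ple[of x], of 2] soliton_sq_bound[OF k, of R x] by simp
  note lim = tendsto_zero_of_sq_le[OF this]
  have i: "integrable lborel (\<lambda>x. W x * g x + wderiv w x * p x)"
    by (intro Bochner_Integration.integrable_add L2_integrable_mult W2 g2 w2 p2)
  \<comment> \<open>Integration by parts with s' as the differentiable factor, since its derivative
    g is explicit; the H1 function enters only through its bounded primitive representative.\<close>
  have 0: "integral\<^sup>L lborel (\<lambda>x. W x * g x + wderiv w x * p x) = 0"
    by (rule primitive_by_parts_UNIV[OF lw W(1) Dp cg i B lim])
  have [measurable]: "w \<in> borel_measurable borel" "wderiv w \<in> borel_measurable borel"
    "wderiv (\<lambda>x. \<gamma> * ?s x) \<in> borel_measurable borel"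
    using H1_L2[OF w] w2 wderiv_H1(1)[OF u] by (auto simp: L2_def)
  have "integral\<^sup>L lborel (\<lambda>x. (\<gamma> * ?s x) * w x + wderiv (\<lambda>x. \<gamma> * ?s x) x * wderiv w x
      - ?s x ^ (2*k+1) * ((2 * real k + 2) * M * \<gamma>) * w x)
    = integral\<^sup>L lborel (\<lambda>x. \<gamma> * (W x * g x + wderiv w x * p x))"
  proof (rule integral_cong_AE)
    show "(\<lambda>x. \<gamma> * (W x * g x + wderiv w x * p x)) \<in> borel_measurable lborel" using i by auto
    show "AE x in lborel. (\<gamma> * ?s x) * w x + wderiv (\<lambda>x. \<gamma> * ?s x) x * wderiv w x
      - ?s x ^ (2*k+1) * ((2 * real k + 2) * M * \<gamma>) * w x = \<gamma> * (W x * g x + wderiv w x * p x)"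
      using ae W(2) by eventually_elim (simp add: g_def algebra_simps)
  qed measurable
  also have "\<dots> = 0" using 0 by simp
  finally show "integral\<^sup>L lborel (\<lambda>x. (\<gamma> * ?s x) * w x + wderiv (\<lambda>x. \<gamma> * ?s x) x * wderiv w x
      - ?s x ^ (2*k+1) * ((2 * real k + 2) * M * \<gamma>) * w x) = 0" .
qed

text \<open>By the first integral, H on the pair is M s^(2k+2) = (s^2 - s'^2)/2. With \<alpha>^2 +
  \<beta>^2 = 1 the terms in s^2 cancel and the two halves of s'^2 add up.\<close>

lemma soliton_pair_action:
  assumes k: "k \<ge> 1" and R: "R > 0" "2 * M * R ^ (2*k) = 1"
    and one: "\<alpha>\<^sup>2 + \<beta>\<^sup>2 = 1" and H: "HH k a b c d \<alpha> \<beta> = M"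
  shows "action k a b c d (\<lambda>x. \<alpha> * soliton k R x) (\<lambda>x. \<beta> * soliton k R x)
    = integral\<^sup>L lborel (\<lambda>x. (- soliton k R x * tanh (real k * x))\<^sup>2)"
proof -
  let ?s = "soliton k R" and ?p = "\<lambda>x. - soliton k R x * tanh (real k * x)"
  note S = soliton_weak_equation[OF k R]
  have i: "integrable lborel (\<lambda>x. (?s x)\<^sup>2)" "integrable lborel (\<lambda>x. (?p x)\<^sup>2)" using S(1,2) by (auto simp: L2_def)
  have HH_eq: "HH k a b c d (\<alpha> * ?s x) (\<beta> * ?s x) = (?s x)\<^sup>2 / 2 - (?p x)\<^sup>2 / 2" for x
  proof -
    have "HH k a b c d (\<alpha> * ?s x) (\<beta> * ?s x) = ?s x ^ (2*k+2) * M"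
      using HH_homogeneous[of k a b c d "?s x" \<alpha> \<beta>] by (simp add: H mult.commute)
    also have "\<dots> = (2 * M * ?s x ^ (2*k)) * (?s x)\<^sup>2 / 2" by (simp add: power_add power2_eq_square)
    also have "\<dots> = (?s x)\<^sup>2 / 2 - (?p x)\<^sup>2 / 2"
      unfolding soliton_power[OF k R(2)] by (simp add: power_mult_distrib left_diff_distrib diff_divide_distrib)
    finally show ?thesis .
  qed
  have "action k a b c d (\<lambda>x. \<alpha> * ?s x) (\<lambda>x. \<beta> * ?s x)
   = 1/2 * (integral\<^sup>L lborel (\<lambda>x. (\<alpha> * ?s x)^2) + integral\<^sup>L lborel (\<lambda>x. (\<beta> * ?s x)^2))
   + 1/2 * (integral\<^sup>L lborel (\<lambda>x. (\<alpha> * ?p x)^2) + integral\<^sup>L lborel (\<lambda>x. (\<beta> * ?p x)^2))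
   - integral\<^sup>L lborel (\<lambda>x. HH k a b c d (\<alpha> * ?s x) (\<beta> * ?s x))"
    using H1_L2[OF S(3)] wderiv_H1(1)[OF S(3)] S(1,2)
    by (intro action_cong_AE S(4)) (auto simp: L2_def simp del: mult_minus_left)
  also have "integral\<^sup>L lborel (\<lambda>x. HH k a b c d (\<alpha> * ?s x) (\<beta> * ?s x))
    = integral\<^sup>L lborel (\<lambda>x. (?s x)\<^sup>2) / 2 - integral\<^sup>L lborel (\<lambda>x. (?p x)\<^sup>2) / 2"
    unfolding HH_eq using i by (subst Bochner_Integration.integral_diff) auto
  also have "1/2 * (integral\<^sup>L lborel (\<lambda>x. (\<alpha> * ?s x)^2) + integral\<^sup>L lborel (\<lambda>x. (\<beta> * ?s x)^2))
    = 1/2 * ((\<alpha>\<^sup>2 + \<beta>\<^sup>2) * integral\<^sup>L lborel (\<lambda>x. (?s x)\<^sup>2))"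
    unfolding power_mult_distrib[of _ "?s _"] integral_mult_right_zero distrib_right ..
  also have "1/2 * (integral\<^sup>L lborel (\<lambda>x. (\<alpha> * ?p x)^2) + integral\<^sup>L lborel (\<lambda>x. (\<beta> * ?p x)^2))
    = 1/2 * ((\<alpha>\<^sup>2 + \<beta>\<^sup>2) * integral\<^sup>L lborel (\<lambda>x. (?p x)\<^sup>2))"
    unfolding power_mult_distrib[of _ "?p _"] integral_mult_right_zero distrib_right ..
  finally show ?thesis unfolding one by simp
qed

theorem theorem3p18:
  fixes k :: nat and a b c d :: real
  assumes "k \<ge> 1" and "a \<ge> 0" and "b \<ge> 0" and "c \<ge> 0" and "d \<ge> 0"
    and "a + b + c + d > 0"
  shows "\<exists>\<phi> \<psi>. ground_state k a b c d \<phi> \<psi>"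
proof -
  note k = assms(1)
  obtain M \<alpha> \<beta> where M: "M > 0" and one: "\<alpha>\<^sup>2 + \<beta>\<^sup>2 = 1"
    and bound: "\<And>u v. HH k a b c d u v \<le> M * (u\<^sup>2 + v\<^sup>2) ^ (k+1)"
    and f: "ff k a b c d \<alpha> \<beta> = (2 * real k + 2) * M * \<alpha>" and g: "gg k a b c d \<alpha> \<beta> = (2 * real k + 2) * M * \<beta>"
    using HH_circle_maximum[OF assms] by blast
  \<comment> \<open>Recovers from the gradient condition and Euler's relation that the bound M is
    attained at (\<alpha>, \<beta>).\<close>
  have "(2 * real k + 2) * HH k a b c d \<alpha> \<beta> = (2 * real k + 2) * M * (\<alpha>\<^sup>2 + \<beta>\<^sup>2)"
    unfolding HH_Euler[OF k, symmetric] f g by (simp add: algebra_simps power2_eq_square)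
  then have H: "HH k a b c d \<alpha> \<beta> = M" using k by (simp add: one)
  \<comment> \<open>The amplitude solving 2 M R^(2k) = 1; its square is the calibration endpoint r,
    the same for the soliton and for every competitor.\<close>
  define R where "R = root (2*k) (1 / (2 * M))"
  have R: "R > 0" "2 * M * R ^ (2*k) = 1" using k M by (simp_all add: R_def)
  have r: "R\<^sup>2 > 0" "2 * M * (R\<^sup>2) ^ k = 1" using R by (simp_all add: power_mult)
  have "continuous_on UNIV (\<lambda>z::real. sqrt \<bar>1 - 2 * M * z ^ k\<bar> / 2)" by (intro continuous_intros) auto
  then obtain K where K: "\<And>z. (K has_real_derivative sqrt \<bar>1 - 2 * M * z ^ k\<bar> / 2) (at z)"
    using continuous_antiderivative by blast
  define \<phi> where "\<phi> = (\<lambda>x. \<alpha> * soliton k R x)"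
  define \<psi> where "\<psi> = (\<lambda>x. \<beta> * soliton k R x)"
  note S = soliton_weak_equation[OF k R]
  have ff_eq: "ff k a b c d (\<phi> x) (\<psi> x) = soliton k R x ^ (2*k+1) * ((2 * real k + 2) * M * \<alpha>)" for x
    using ff_homogeneous[OF k, of a b c d "soliton k R x" \<alpha> \<beta>] by (simp add: \<phi>_def \<psi>_def f mult.commute)
  have gg_eq: "gg k a b c d (\<phi> x) (\<psi> x) = soliton k R x ^ (2*k+1) * ((2 * real k + 2) * M * \<beta>)" for x
    using gg_homogeneous[OF k, of a b c d "soliton k R x" \<alpha> \<beta>] by (simp add: \<phi>_def \<psi>_def g mult.commute)
  have sol: "weak_solution k a b c d \<phi> \<psi>"
    unfolding weak_solution_def ff_eq gg_eq using S(3,5) by (simp add: \<phi>_def \<psi>_def)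
  have nz: "\<not> is_zero_pair \<phi> \<psi>"
  proof
    have ne: "\<not> (\<phi> x = 0 \<and> \<psi> x = 0)" for x
      using one soliton_pos[OF R(1), of k x] by (auto simp: \<phi>_def \<psi>_def)
    assume "is_zero_pair \<phi> \<psi>"
    then have "AE x in lborel. \<phi> x = 0 \<and> \<psi> x = 0" by (simp add: is_zero_pair_def)
    then have "AE x in (lborel :: real measure). False"
      by eventually_elim (use ne in blast)
    then have "ae_filter (lborel :: real measure) = bot" by (simp add: trivial_limit_def)
    then show False by (simp add: ae_filter_eq_bot_iff)
  qed
  have "action k a b c d \<phi> \<psi> = integral\<^sup>L lborel (\<lambda>x. (- soliton k R x * tanh (real k * x))\<^sup>2)"
    unfolding \<phi>_def \<psi>_def by (rule soliton_pair_action[OF k R one H])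
  also have "\<dots> \<le> 2 * (K (R\<^sup>2) - K 0)"
    using S(2) by (intro soliton_calibration_upper_bound[OF k R K]) (simp add: L2_def)
  finally have le: "action k a b c d \<phi> \<psi> \<le> 2 * (K (R\<^sup>2) - K 0)" .
  have "Inf {action k a b c d u v | u v. \<not> is_zero_pair u v \<and> weak_solution k a b c d u v} = action k a b c d \<phi> \<psi>"
  proof (rule cInf_eq_minimum)
    show "action k a b c d \<phi> \<psi> \<in> {action k a b c d u v | u v. \<not> is_zero_pair u v \<and> weak_solution k a b c d u v}"
      using sol nz by blast
    fix y assume "y \<in> {action k a b c d u v | u v. \<not> is_zero_pair u v \<and> weak_solution k a b c d u v}"
    then obtain u v where y: "y = action k a b c d u v" "\<not> is_zero_pair u v" "weak_solution k a b c d u v" by blast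
    have "2 * (K (R\<^sup>2) - K 0) \<le> y"
      unfolding y(1) by (rule weak_solution_action_lower_bound[OF k assms(2-5) M bound r K y(3,2)])
    then show "action k a b c d \<phi> \<psi> \<le> y" using le by linarith
  qed
  then have "ground_state k a b c d \<phi> \<psi>" unfolding ground_state_def using sol nz by simp
  then show ?thesis by blast
qed

end
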